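(* Let $\mathcal{A}\in\mathbb{R}^{n\times n\times p}$ be T-SPD, $d=np$, with T-eigenvalues $\lambda_1>\lambda_2\ge\cdots\ge\lambda_d>0$. Let $\gamma:=1-\lambda_2/\lambda_1>0$ and let $\mathbf{v}_1$ be a unit eigenvector of $\operatorname{bcirc}(\mathcal{A})$ for $\lambda_1$. Let $\mathbf{x}_0$ be drawn uniformly from the unit sphere in $\mathbb{R}^d$, let $\theta_0\in[0,\pi/2]$ be the angle between $\mathbf{x}_0$ and $\mathbf{v}_1$ (i.e. $\cos\theta_0=|\mathbf{v}_1^{\mathsf T}\mathbf{x}_0|$), and for each integer $q\ge 0$ let $\hat\lambda_1^{\rm pow}=\hat\lambda_1^{\rm pow}(q)$ be the Rayleigh quotient obtained after $q$ steps of the power iteration on $\operatorname{bcirc}(\mathcal{A})$ started from $\mathbf{x}_0$. Then: (a) (Pathwise) for every realisation of $\mathbf{x}_0$ with $\cos\theta_0\neq 0$, $$\lambda_1-\hat\lambda_1^{\rm pow}\;\le\;\lambda_1(1-\gamma)^{2q}\tan^2\theta_0 .$$ (b) (Probabilistic) there exists a universal constant $0<c\le 0.824$ (independent of $\mathcal{A}$, $d$, $q$, $\delta$) such that, for every $\delta\in(0,1)$, with probability at least $1-\delta$ over the draw of $\mathbf{x}_0$, $$\tan^2\theta_0\;\le\;\frac{c^2 d}{\delta^2}.$$ Consequently, with this constant $c$, for every $\delta\in(0,1)$, with probability at least $1-\delta$, $$\lambda_1-\hat\lambda_1^{\rm pow}\;\le\;\frac{c^2 d\,\lambda_1}{\delta^2}(1-\gamma)^{2q}.$$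 In particular, $\hat\lambda_1^{\rm pow}(q)\to\lambda_1$ almost surely as $q\to\infty$, exponentially fast in $q$: almost surely $\lambda_1-\hat\lambda_1^{\rm pow}(q)=O((1-\gamma)^{2q})$.
   Context: For $\mathcal{A}\in\mathbb{R}^{n\times n\times p}$ with frontal slices $\mathcal{A}^{(1)},\dots,\mathcal{A}^{(p)}\in\mathbb{R}^{n\times n}$, $\operatorname{bcirc}(\mathcal{A})\in\mathbb{R}^{np\times np}$ is the block circulant matrix whose $(i,j)$ block ($1\le i,j\le p$) is $\mathcal{A}^{(((i-j)\bmod p)+1)}$. The tensor $\mathcal{A}$ is T-SPD if $\operatorname{bcirc}(\mathcal{A})$ is symmetric positive definite. The T-eigenvalues of $\mathcal{A}$ are the eigenvalues of $\operatorname{bcirc}(\mathcal{A})$, counted with multiplicity. Power iteration: given a unit vector $\mathbf{x}_0\in\mathbb{R}^d$, for $k=1,\dots,q$ set $\mathbf{y}_k=\operatorname{bcirc}(\mathcal{A})\mathbf{x}_{k-1}$ and $\mathbf{x}_k=\mathbf{y}_k/\|\mathbf{y}_k\|_2$; the Rayleigh quotient is $\hat\lambda_1^{\rm pow}(q)=\mathbf{x}_q^{\mathsf T}\operatorname{bcirc}(\mathcal{A})\mathbf{x}_q$. The iterates for different $q$ use the same $\mathbf{x}_0$. *)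

theory Defs
  imports
    "HOL-Probability.Probability"
    "HOL-Library.Landau_Symbols"
    "Jordan_Normal_Form.Char_Poly"
begin

unbundle no vec_syntax
no_notation inner (infixl "\<bullet>" 70)
hide_const (open) Finite_Cartesian_Product.mat Finite_Cartesian_Product.vec
hide_const (open) Determinants.det

section \<open>Euclidean structure and the uniform distribution on the sphere\<close>

text \<open>
  The constant \<open>c\<close> of the theorem does not depend on the dimension \<open>d\<close>, so \<open>d\<close> is quantified
  inside the formula and \<open>\<real>\<^sup>d\<close> is \<^term>\<open>carrier_vec d :: real vec set\<close>.
\<close>

definition vnorm :: "real vec \<Rightarrow> real" where
  "vnorm x = sqrt (x \<bullet> x)"

definition normalize_vec :: "real vec \<Rightarrow> real vec" where
  "normalize_vec x = (1 / vnorm x) \<cdot>\<^sub>v x"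

definition unit_sphere :: "nat \<Rightarrow> real vec set" where
  "unit_sphere d = {x \<in> carrier_vec d. vnorm x = 1}"

definition unit_ball :: "nat \<Rightarrow> real vec set" where
  "unit_ball d = {x \<in> carrier_vec d. vnorm x \<le> 1}"

definition borel_vec :: "nat \<Rightarrow> real vec measure" where
  "borel_vec d = vimage_algebra (carrier_vec d) (\<lambda>x. \<lambda>i\<in>{..<d}. x $ i) (Pi\<^sub>M {..<d} (\<lambda>_. borel))"

definition lborel_vec :: "nat \<Rightarrow> real vec measure" where
  "lborel_vec d = distr (Pi\<^sub>M {..<d} (\<lambda>_. lborel)) (borel_vec d) (Matrix.vec d)"

text \<open>
  Normalised surface measure, as the cone measure: the radial projection to the sphere of the
  uniform distribution on the unit ball. The value of \<^const>\<open>normalize_vec\<close> at the origin is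
  irrelevant, the origin being a null set for \<open>d \<ge> 1\<close>.
\<close>

definition uniform_sphere :: "nat \<Rightarrow> real vec measure" where
  "uniform_sphere d =
     restrict_space
       (distr (uniform_measure (lborel_vec d) (unit_ball d)) (borel_vec d) normalize_vec)
       (unit_sphere d)"

lemma measurable_borel_vec_index:
  assumes "i < d" shows "(\<lambda>x. x $ i) \<in> borel_measurable (borel_vec d)"
proof -
  have "(\<lambda>x. \<lambda>i\<in>{..<d}. x $ i) \<in> measurable (borel_vec d) (Pi\<^sub>M {..<d} (\<lambda>_. borel))"
    unfolding borel_vec_def by (rule measurable_vimage_algebra1) (auto simp: space_PiM)
  from measurable_compose[OF this measurable_component_singleton[of i]] assms
  show ?thesis by simp
qed

lemma measurable_into_borel_vec:
  assumes "g \<in> space M \<rightarrow> carrier_vec d"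
    and "\<And>i. i < d \<Longrightarrow> (\<lambda>x. g x $ i) \<in> borel_measurable M"
  shows "g \<in> measurable M (borel_vec d)"
  unfolding borel_vec_def
  by (rule measurable_vimage_algebra2) (use assms in \<open>auto intro!: measurable_restrict\<close>)

lemma space_borel_vec [simp]: "space (borel_vec d) = carrier_vec d"
  by (simp add: borel_vec_def)

lemma measurable_vnorm: "vnorm \<in> borel_measurable (borel_vec d)"
proof -
  have "(\<lambda>x. sqrt (\<Sum>i<d. x $ i * x $ i)) \<in> borel_measurable (borel_vec d)"
    by (intro measurable_compose[OF _ borel_measurable_sqrt] borel_measurable_sum borel_measurable_times measurable_borel_vec_index) auto
  then show ?thesis
    by (rule measurable_cong[THEN iffD1, rotated])
      (auto simp: vnorm_def scalar_prod_def atLeast0LessThan)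
qed

lemma measurable_normalize_vec: "normalize_vec \<in> measurable (borel_vec d) (borel_vec d)"
proof (rule measurable_into_borel_vec)
  show "normalize_vec \<in> space (borel_vec d) \<rightarrow> carrier_vec d"
    by (auto simp: normalize_vec_def)
  fix i assume "i < d"
  then have "(\<lambda>x. 1 / vnorm x * x $ i) \<in> borel_measurable (borel_vec d)"
    by (intro borel_measurable_times borel_measurable_divide measurable_vnorm measurable_borel_vec_index) auto
  then show "(\<lambda>x. normalize_vec x $ i) \<in> borel_measurable (borel_vec d)"
    by (rule measurable_cong[THEN iffD1, rotated])
      (use \<open>i < d\<close> in \<open>auto simp: normalize_vec_def\<close>)
qed

lemma measurable_vec: "Matrix.vec d \<in> measurable (Pi\<^sub>M {..<d} (\<lambda>_. lborel)) (borel_vec d)"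
proof (rule measurable_into_borel_vec)
  fix i assume "i < d"
  then have "(\<lambda>x. x i) \<in> measurable (Pi\<^sub>M {..<d} (\<lambda>_. lborel :: real measure)) lborel"
    by (intro measurable_component_singleton) auto
  then show "(\<lambda>x. Matrix.vec d x $ i) \<in> borel_measurable (Pi\<^sub>M {..<d} (\<lambda>_. lborel))"
    using \<open>i < d\<close> by simp
qed auto

lemma vnorm_sq: "x \<in> carrier_vec d \<Longrightarrow> (vnorm x)\<^sup>2 = (\<Sum>i<d. (x $ i)\<^sup>2)"
  by (simp add: vnorm_def scalar_prod_def atLeast0LessThan power2_eq_square sum_nonneg)

lemma vnorm_vec_le: "vnorm (Matrix.vec d x) \<le> 1 \<longleftrightarrow> (\<Sum>i<d. (x i)\<^sup>2) \<le> 1"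
  by (simp add: vnorm_def scalar_prod_def atLeast0LessThan power2_eq_square)

lemma sets_unit_ball: "unit_ball d \<in> sets (borel_vec d)"
proof -
  have "{x \<in> space (borel_vec d). vnorm x \<le> 1} \<in> sets (borel_vec d)"
    using measurable_vnorm[of d] by measurable
  then show ?thesis by (simp add: unit_ball_def)
qed

lemma sets_unit_sphere: "unit_sphere d \<in> sets (borel_vec d)"
proof -
  have "{x \<in> space (borel_vec d). vnorm x = 1} \<in> sets (borel_vec d)"
    using measurable_vnorm[of d] by measurable
  then show ?thesis by (simp add: unit_sphere_def)
qed

lemma emeasure_lborel_box:
  "emeasure (Pi\<^sub>M {..<d::nat} (\<lambda>_. lborel)) (PiE {..<d} (\<lambda>_. {a..b::real})) = (\<Prod>i<d. emeasure lborel {a..b})"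
proof -
  interpret lb: product_sigma_finite "\<lambda>_::nat. lborel :: real measure" ..
  show ?thesis using lb.emeasure_PiM[of "{..<d}" "\<lambda>_. {a..b}"] by simp
qed

lemma space_uniform_sphere [simp]: "space (uniform_sphere d) = unit_sphere d"
  by (auto simp: uniform_sphere_def space_restrict_space unit_sphere_def)

lemma prob_space_uniform_sphere:
  assumes "d > 0" shows "prob_space (uniform_sphere d)"
proof -
  let ?L = "Pi\<^sub>M {..<d} (\<lambda>_. lborel :: real measure)"
  interpret lb: product_sigma_finite "\<lambda>_::nat. lborel :: real measure" ..
  have S: "sets (lborel_vec d) = sets (borel_vec d)" by (simp add: lborel_vec_def)
  have B: "emeasure (lborel_vec d) (unit_ball d) = emeasure ?L {x \<in> space ?L. (\<Sum>i<d. (x i)\<^sup>2) \<le> 1}"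
    unfolding lborel_vec_def
    by (subst emeasure_distr[OF measurable_vec sets_unit_ball])
       (auto intro!: arg_cong2[where f=emeasure] simp: unit_ball_def vnorm_vec_le)
  let ?b = "{x \<in> space ?L. (\<Sum>i<d. (x i)\<^sup>2) \<le> 1}"
  have mb: "?b \<in> sets ?L"
    by measurable
  have "?b \<subseteq> PiE {..<d} (\<lambda>_. {-1..1})"
  proof
    fix x assume x: "x \<in> ?b"
    have "x i \<in> {-1..1}" if "i < d" for i
    proof -
      have "(x i)\<^sup>2 \<le> (\<Sum>i<d. (x i)\<^sup>2)" using that by (intro member_le_sum) auto
      with x have "(x i)\<^sup>2 \<le> 1" by auto
      then show ?thesis by (simp add: abs_square_le_1 abs_le_iff)
    qed
    then show "x \<in> PiE {..<d} (\<lambda>_. {-1..1})" using x by (auto simp: space_PiM PiE_iff)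
  qed
  then have "emeasure ?L ?b \<le> (\<Prod>i<d. emeasure lborel {-1..1::real})"
    unfolding emeasure_lborel_box[symmetric] by (intro emeasure_mono) auto
  also have "\<dots> < \<infinity>" by (simp add: ennreal_power[symmetric] power_less_top_ennreal)
  finally have fin: "emeasure ?L ?b < \<infinity>" .
  let ?r = "1 / real d"
  have "PiE {..<d} (\<lambda>_. {0..?r}) \<subseteq> ?b"
  proof
    fix x assume x: "x \<in> PiE {..<d} (\<lambda>_. {0..?r})"
    have "(x i)\<^sup>2 \<le> ?r" if "i < d" for i
    proof -
      have xi: "0 \<le> x i" "x i \<le> ?r" using x that by (auto simp: PiE_iff)
      moreover have "?r \<le> 1" using assms by simp
      ultimately have "x i * x i \<le> 1 * ?r" by (intro mult_mono) auto
      then show ?thesis by (simp add: power2_eq_square)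
    qed
    then have "(\<Sum>i<d. (x i)\<^sup>2) \<le> (\<Sum>i<d. ?r)" by (intro sum_mono) auto
    also have "\<dots> = 1" using assms by simp
    finally show "x \<in> ?b" using x by (auto simp: space_PiM PiE_iff)
  qed
  then have "(\<Prod>i<d. emeasure lborel {0..?r}) \<le> emeasure ?L ?b"
    unfolding emeasure_lborel_box[symmetric] by (intro emeasure_mono mb)
  moreover have "(\<Prod>i<d. emeasure lborel {0..?r}) > 0"
    using assms by (simp add: zero_less_power ennreal_power ennreal_zero_less_divide)
  ultimately have pos: "emeasure ?L ?b \<noteq> 0" by auto
  interpret U: prob_space "uniform_measure (lborel_vec d) (unit_ball d)"
    by (rule prob_space_uniform_measure) (use B pos fin in auto)
  have mn: "normalize_vec \<in> measurable (uniform_measure (lborel_vec d) (unit_ball d)) (borel_vec d)"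
    using measurable_normalize_vec[of d] S by (simp cong: measurable_cong_sets)
  interpret D: prob_space "distr (uniform_measure (lborel_vec d) (unit_ball d)) (borel_vec d) normalize_vec"
    by (rule U.prob_space_distr[OF mn])
  have z: "AE x in ?L. x 0 \<noteq> 0"
  proof (rule AE_I)
    let ?N = "PiE {..<d} (\<lambda>i. if i = 0 then {0} else UNIV :: real set)"
    show "{x \<in> space ?L. \<not> x 0 \<noteq> 0} \<subseteq> ?N" by (auto simp: space_PiM PiE_iff extensional_def)
    show "?N \<in> sets ?L" by (intro sets_PiM_I_finite) auto
    have "emeasure ?L ?N = (\<Prod>i<d. emeasure lborel (if i = 0 then {0} else UNIV :: real set))"
      by (intro lb.emeasure_PiM) auto
    also have "\<dots> = 0" using assms by (intro prod_zero) (auto intro!: bexI[of _ 0])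
    finally show "emeasure ?L ?N = 0" .
  qed
  have "AE x in lborel_vec d. normalize_vec x \<in> unit_sphere d"
  proof -
    have "AE x in ?L. normalize_vec (Matrix.vec d x) \<in> unit_sphere d"
      using z
    proof eventually_elim
      case (elim x)
      let ?v = "Matrix.vec d x"
      have "0 < (x 0)\<^sup>2" using elim by simp
      also have "\<dots> \<le> (\<Sum>i<d. (x i)\<^sup>2)" using assms by (intro member_le_sum) auto
      finally have p: "?v \<bullet> ?v > 0" by (simp add: scalar_prod_def atLeast0LessThan power2_eq_square)
      then have "vnorm (normalize_vec ?v) = 1"
        by (simp add: vnorm_def normalize_vec_def)
      then show ?case by (simp add: unit_sphere_def normalize_vec_def)
    qed
    then show ?thesis unfolding lborel_vec_def
    proof (subst AE_distr_iff[OF measurable_vec])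
      show "{x \<in> space (borel_vec d). normalize_vec x \<in> unit_sphere d} \<in> sets (borel_vec d)"
        using measurable_sets[OF measurable_normalize_vec sets_unit_sphere, of d]
        by (simp add: vimage_def Int_def conj_commute)
    qed
  qed
  then have ae: "AE x in uniform_measure (lborel_vec d) (unit_ball d). normalize_vec x \<in> unit_sphere d"
    by (intro AE_uniform_measureI) (auto simp: S sets_unit_ball)
  have "emeasure (distr (uniform_measure (lborel_vec d) (unit_ball d)) (borel_vec d) normalize_vec) (unit_sphere d) = 1"
    unfolding emeasure_distr[OF mn sets_unit_sphere]
    by (rule U.emeasure_eq_1_AE[OF _ ]) (use ae measurable_sets[OF mn sets_unit_sphere] in auto)
  then show ?thesis
    using sets_unit_sphere[of d] sets.sets_into_space[OF sets_unit_sphere[of d]]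
    by (intro prob_spaceI)
      (simp add: space_uniform_sphere uniform_sphere_def emeasure_restrict_space Int_absorb2)
qed

text \<open>The angle in \<open>[0, \<pi>/2]\<close> between the lines spanned by two unit vectors.\<close>

definition line_angle :: "real vec \<Rightarrow> real vec \<Rightarrow> real" where
  "line_angle u v = arccos \<bar>u \<bullet> v\<bar>"


section \<open>Third-order tensors\<close>

text \<open>
  A tensor in \<open>\<real>\<^sup>n\<^sup>\<times>\<^sup>n\<^sup>\<times>\<^sup>p\<close> is given by its frontal slices \<open>A 1, \<dots>, A p\<close>. Matrix indices start
  at \<open>0\<close>, so entry \<open>(r, s)\<close> lies in the block with zero-based indices \<open>(r div n, s div n)\<close>;
  the shift of the block indices does not affect their difference.
\<close>

definition carrier_tensor :: "nat \<Rightarrow> nat \<Rightarrow> (nat \<Rightarrow> real mat) set" where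
  "carrier_tensor n p = {A. \<forall>k\<in>{1..p}. A k \<in> carrier_mat n n}"

definition bcirc :: "nat \<Rightarrow> nat \<Rightarrow> (nat \<Rightarrow> real mat) \<Rightarrow> real mat" where
  "bcirc n p A =
     Matrix.mat (n * p) (n * p)
       (\<lambda>(r, s). A (nat ((int (r div n) - int (s div n)) mod int p) + 1) $$ (r mod n, s mod n))"

definition sym_pos_def :: "real mat \<Rightarrow> bool" where
  "sym_pos_def B \<longleftrightarrow>
     square_mat B \<and> B\<^sup>T = B \<and>
     (\<forall>x\<in>carrier_vec (dim_row B). x \<noteq> 0\<^sub>v (dim_row B) \<longrightarrow> x \<bullet> (B *\<^sub>v x) > 0)"

definition T_SPD :: "nat \<Rightarrow> nat \<Rightarrow> (nat \<Rightarrow> real mat) \<Rightarrow> bool" where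
  "T_SPD n p A \<longleftrightarrow> sym_pos_def (bcirc n p A)"

text \<open>
  Only real eigenvalues are collected, which are all of them when \<open>bcirc\<close> is symmetric.
\<close>

definition T_eigenvalues :: "nat \<Rightarrow> nat \<Rightarrow> (nat \<Rightarrow> real mat) \<Rightarrow> real multiset" where
  "T_eigenvalues n p A = proots (char_poly (bcirc n p A))"


section \<open>Power iteration\<close>

primrec power_iterate :: "real mat \<Rightarrow> real vec \<Rightarrow> nat \<Rightarrow> real vec" where
  "power_iterate B x0 0 = x0"
| "power_iterate B x0 (Suc k) = normalize_vec (B *\<^sub>v power_iterate B x0 k)"

definition rayleigh_pow :: "real mat \<Rightarrow> real vec \<Rightarrow> nat \<Rightarrow> real" where
  "rayleigh_pow B x0 q = power_iterate B x0 q \<bullet> (B *\<^sub>v power_iterate B x0 q)"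

end

theory Submission
  imports Defs
begin

text \<open>
  Write \<open>c = x\<^sub>0 \<bullet> v\<^sub>1\<close> and \<open>B\<^sup>q x\<^sub>0 = c \<lambda>\<^sub>1\<^sup>q v\<^sub>1 + w\<close> with \<open>w\<close> orthogonal to \<open>v\<^sub>1\<close>.
  On the orthogonal complement of \<open>v\<^sub>1\<close> the matrix has norm at most \<open>\<lambda>\<^sub>2\<close>, so
  \<open>|w|\<^sup>2 \<le> \<lambda>\<^sub>2\<^bsup>2q\<^esup> (1 - c\<^sup>2)\<close>, while the Rayleigh quotient misses \<open>\<lambda>\<^sub>1\<close> by at most
  \<open>\<lambda>\<^sub>1 |w|\<^sup>2 / (c\<^sup>2 \<lambda>\<^sub>1\<^bsup>2q\<^esup>)\<close>; this is the pathwise bound.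

  For the tail of \<open>tan \<theta>\<^sub>0\<close>, rotate \<open>v\<^sub>1\<close> to the first basis vector and use the coordinates \<open>(s, y)\<close>
  with \<open>x = (s |y|, y)\<close> on the ball, so that \<open>s = cot \<theta>\<^sub>0\<close> up to sign. In these coordinates \<open>s\<close> has
  density proportional to \<open>(1 + s\<^sup>2)\<^bsup>-d/2\<^esup>\<close>, which is at most \<open>1\<close> and at least
  \<open>exp (- d s\<^sup>2 / 2)\<close>, a function of integral \<open>sqrt (2 \<pi> / d)\<close>. Hence
  \<open>P (|s| \<le> t) \<le> 2 t sqrt (d / (2 \<pi>))\<close>, and \<open>t = \<delta> / (c sqrt d)\<close> gives probability at most
  \<open>\<delta>\<close> as soon as \<open>c \<ge> sqrt (2 / \<pi>) \<approx> 0.798\<close>.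
\<close>

no_notation inner (infix "\<bullet>" 70)

section \<open>Householder reflections and deflation\<close>

lemma scalar_prod_symmetric_mat:
  fixes A :: "'a :: comm_semiring_0 mat"
  assumes "A \<in> carrier_mat n n" "A\<^sup>T = A" "x \<in> carrier_vec n" "y \<in> carrier_vec n"
  shows "(A *\<^sub>v x) \<bullet> y = x \<bullet> (A *\<^sub>v y)"
  using transpose_vec_mult_scalar[OF assms(1,4,3)] assms(2) by simp

text \<open>
  The reflection is written as \<open>x \<mapsto> x - \<kappa> (u \<bullet> x) u\<close> with \<open>u = v - e\<^sub>0\<close> and
  \<open>\<kappa> = 2 / |u|\<^sup>2 = 1 / (1 - v\<^sub>0)\<close>; for \<open>v = e\<^sub>0\<close> the convention \<open>1 / 0 = 0\<close> makes it
  the identity.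
\<close>

definition householder_dir :: "(nat \<Rightarrow> real) \<Rightarrow> nat \<Rightarrow> real" where
  "householder_dir v i = v i - (if i = 0 then 1 else 0)"

definition householder_coeff :: "(nat \<Rightarrow> real) \<Rightarrow> real" where
  "householder_coeff v = 1 / (1 - v 0)"

lemma sum_householder_dir:
  assumes "0 < d"
  shows "(\<Sum>i<d. householder_dir v i * x i) = (\<Sum>i<d. v i * x i) - x 0"
proof -
  have "(\<Sum>i<d. householder_dir v i * x i) = (\<Sum>i<d. v i * x i - (if i = 0 then x i else 0))"
    by (intro sum.cong) (auto simp: householder_dir_def algebra_simps)
  then show ?thesis using assms by (simp add: sum_subtractf)
qed

lemma householder_dir_sq:
  assumes "0 < d" "(\<Sum>i<d. (v i)\<^sup>2) = 1"
  shows "(\<Sum>i<d. (householder_dir v i)\<^sup>2) = 2 * (1 - v 0)"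
proof -
  have "(\<Sum>i<d. (householder_dir v i)\<^sup>2) = (\<Sum>i<d. v i * householder_dir v i) - householder_dir v 0"
    using sum_householder_dir[OF assms(1), of v "householder_dir v"] by (simp add: power2_eq_square)
  also have "(\<Sum>i<d. v i * householder_dir v i) = 1 - v 0"
    using sum_householder_dir[OF assms(1), of v v] assms(2) by (simp add: power2_eq_square mult.commute)
  finally show ?thesis by (simp add: householder_dir_def)
qed

text \<open>A unit vector whose first entry is 1 is the first basis vector, so its squared distance
  to it vanishes. This settles the case in which \<open>householder_coeff\<close> divides by
  zero.\<close>

lemma householder_dir_eq_0:
  assumes "0 < d" "(\<Sum>i<d. (v i)\<^sup>2) = 1" "v 0 = 1" "i < d"
  shows "householder_dir v i = 0"
proof -
  have "(\<Sum>i<d. (householder_dir v i)\<^sup>2) = 0"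
    using householder_dir_sq[OF assms(1,2)] assms(3) by simp
  then show ?thesis using assms(4) by (simp add: sum_nonneg_eq_0_iff)
qed

definition householder :: "nat \<Rightarrow> (nat \<Rightarrow> real) \<Rightarrow> real mat" where
  "householder d v = Matrix.mat d d (\<lambda>(i, j). (if i = j then 1 else 0)
      - householder_coeff v * householder_dir v i * householder_dir v j)"

lemma householder_carrier [simp]: "householder d v \<in> carrier_mat d d"
  by (simp add: householder_def)

lemma dim_householder [simp]: "dim_row (householder d v) = d" "dim_col (householder d v) = d"
  by (simp_all add: householder_def)

lemma transpose_householder: "(householder d v)\<^sup>T = householder d v"
  by (intro eq_matI) (auto simp: householder_def)

lemma householder_mult_vec_index:
  assumes "x \<in> carrier_vec d" "i < d"
  shows "(householder d v *\<^sub>v x) $ i =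
    x $ i - householder_coeff v * (\<Sum>j<d. householder_dir v j * x $ j) * householder_dir v i"
proof -
  have "(householder d v *\<^sub>v x) $ i = (\<Sum>j<d. ((if i = j then 1 else 0)
      - householder_coeff v * householder_dir v i * householder_dir v j) * x $ j)"
    using assms by (simp add: householder_def scalar_prod_def atLeast0LessThan)
  also have "\<dots> = (\<Sum>j<d. (if i = j then x $ j else 0)) - householder_coeff v * (\<Sum>j<d. householder_dir v j * x $ j) * householder_dir v i"
    unfolding sum_distrib_left sum_distrib_right sum_subtractf[symmetric]
    by (intro sum.cong) (auto simp: algebra_simps)
  finally show ?thesis using assms(2) by simp
qed

text \<open>Away from the degenerate case the reflection turns the inner product \<open>s\<close>
  with the direction into \<open>-s\<close>, so the second application adds back exactly what the
  first one subtracted.\<close>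

lemma householder_involution:
  assumes "0 < d" "(\<Sum>i<d. (v i)\<^sup>2) = 1" "x \<in> carrier_vec d"
  shows "householder d v *\<^sub>v (householder d v *\<^sub>v x) = x"
proof (intro eq_vecI)
  define h k where "h = householder_dir v" and "k = householder_coeff v"
  define s where "s = (\<Sum>j<d. h j * x $ j)"
  define y where "y = householder d v *\<^sub>v x"
  show "dim_vec (householder d v *\<^sub>v (householder d v *\<^sub>v x)) = dim_vec x"
    using assms(3) by simp
  fix i assume "i < dim_vec x"
  then have i: "i < d" using assms(3) by simp
  have y: "y \<in> carrier_vec d" by (intro carrier_vecI) (simp add: y_def)
  have yj: "y $ j = x $ j - k * s * h j" if "j < d" for j
    unfolding y_def householder_mult_vec_index[OF assms(3) that] by (simp only: h_def k_def s_def)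
  have "(\<Sum>j<d. h j * y $ j) = (\<Sum>j<d. h j * x $ j - k * s * (h j)\<^sup>2)"
    by (intro sum.cong refl) (simp add: yj power2_eq_square right_diff_distrib)
  also have "\<dots> = s - k * s * (2 * (1 - v 0))"
    using householder_dir_sq[OF assms(1,2)]
    by (simp add: sum_subtractf s_def h_def flip: sum_distrib_left)
  finally have hy: "(\<Sum>j<d. h j * y $ j) = s - k * s * (2 * (1 - v 0))" .
  \<comment> \<open>Either \<open>k\<close> is a genuine inverse of \<open>1 - v 0\<close>, or the
    direction is zero and nothing is subtracted at all.\<close>
  have "s = k * s * (1 - v 0) \<or> h i = 0"
    using householder_dir_eq_0[OF assms(1,2) _ i]
    by (cases "v 0 = 1") (simp_all add: h_def k_def householder_coeff_def)
  then have "x $ i - k * s * h i - k * (s - k * s * (2 * (1 - v 0))) * h i = x $ i"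
  proof
    assume "s = k * s * (1 - v 0)"
    then have "k * s * (2 * (1 - v 0)) = 2 * s" by (metis mult.assoc mult.commute)
    then show ?thesis by (simp only:) simp
  qed simp
  moreover have "(householder d v *\<^sub>v y) $ i = y $ i - k * (\<Sum>j<d. h j * y $ j) * h i"
    unfolding householder_mult_vec_index[OF y i] h_def k_def ..
  ultimately show "(householder d v *\<^sub>v (householder d v *\<^sub>v x)) $ i = x $ i"
    using yj[OF i] unfolding y_def[symmetric] hy by simp
qed

lemma householder_square:
  assumes "0 < d" "(\<Sum>i<d. (v i)\<^sup>2) = 1"
  shows "householder d v * householder d v = 1\<^sub>m d"
proof (intro eq_matI)
  fix i j assume ij: "i < dim_row (1\<^sub>m d :: real mat)" "j < dim_col (1\<^sub>m d :: real mat)"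
  have "(householder d v * householder d v) $$ (i, j) = ((householder d v * householder d v) *\<^sub>v unit_vec d j) $ i"
    using ij by simp
  also have "\<dots> = unit_vec d j $ i"
    using householder_involution[OF assms, of "unit_vec d j"] by (subst assoc_mult_mat_vec[of _ d d _ d]) auto
  finally show "(householder d v * householder d v) $$ (i, j) = 1\<^sub>m d $$ (i, j)"
    using ij by (auto simp: unit_vec_def)
qed auto

text \<open>With the involution property this says that the reflection exchanges \<open>v\<close>
  and the first basis vector.\<close>

lemma householder_unit_vec:
  assumes "0 < d" "(\<Sum>i<d. (v i)\<^sup>2) = 1"
  shows "householder d v *\<^sub>v unit_vec d 0 = Matrix.vec d v"
proof (intro eq_vecI)
  fix i assume "i < dim_vec (Matrix.vec d v)"
  then have i: "i < d" by simp
  have "(\<Sum>j<d. householder_dir v j * unit_vec d 0 $ j) = v 0 - 1"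
    using assms(1) by (subst sum_householder_dir)
      (auto simp: unit_vec_def if_distrib sum.delta cong: if_cong)
  then have "(householder d v *\<^sub>v unit_vec d 0) $ i
      = (if i = 0 then 1 else 0) - householder_coeff v * (v 0 - 1) * householder_dir v i"
    using i by (subst householder_mult_vec_index) (auto simp: unit_vec_def)
  also have "householder_coeff v * (v 0 - 1) * householder_dir v i = - householder_dir v i"
    using householder_dir_eq_0[OF assms _ i]
    by (cases "v 0 = 1") (simp_all add: householder_coeff_def field_simps)
  finally show "(householder d v *\<^sub>v unit_vec d 0) $ i = Matrix.vec d v $ i"
    using i by (simp add: householder_dir_def)
qed auto

section \<open>Splitting off a known eigenvector from a symmetric matrix\<close>

lemma scalar_prod_Suc:
  fixes y z :: "'a :: comm_semiring_0 vec"
  assumes "y \<in> carrier_vec (Suc n)" "z \<in> carrier_vec (Suc n)"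
  shows "y \<bullet> z = y $ 0 * z $ 0 + Matrix.vec n (\<lambda>i. y $ Suc i) \<bullet> Matrix.vec n (\<lambda>i. z $ Suc i)"
  using assms by (simp add: scalar_prod_def sum.atLeast0_lessThan_Suc_shift del: sum.op_ivl_Suc)

text \<open>Conjugation with the reflection \<open>H\<close> exchanging \<open>v\<close> and the
  first basis vector gives a symmetric \<open>C\<close> whose first column is \<open>e\<close> times
  that basis vector. By symmetry the first row has the same shape, so \<open>C\<close> is block
  diagonal and \<open>A'\<close> is its lower block. As \<open>H\<close> is an isometry, the
  orthogonal complement of \<open>v\<close> corresponds to the vectors with first coordinate 0; only
  norms are carried over, which is all that the later bounds use.\<close>

lemma eigenvector_deflation:
  fixes A :: "real mat"
  assumes A: "A \<in> carrier_mat (Suc n) (Suc n)" and sym: "A\<^sup>T = A"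
    and v: "v \<in> carrier_vec (Suc n)" "v \<bullet> v = 1" and ev: "A *\<^sub>v v = e \<cdot>\<^sub>v v"
  obtains A' where "A' \<in> carrier_mat n n" "A'\<^sup>T = A'" "char_poly A = [:- e, 1:] * char_poly A'"
    "\<And>w. w \<in> carrier_vec (Suc n) \<Longrightarrow> w \<bullet> v = 0 \<Longrightarrow>
       \<exists>w'\<in>carrier_vec n. w' \<bullet> w' = w \<bullet> w \<and> (A' *\<^sub>v w') \<bullet> (A' *\<^sub>v w') = (A *\<^sub>v w) \<bullet> (A *\<^sub>v w)"
proof -
  let ?d = "Suc n"
  define H where "H = householder ?d (\<lambda>i. v $ i)"
  have "(\<Sum>i<?d. (v $ i)\<^sup>2) = 1"
    using v by (simp add: scalar_prod_def atLeast0LessThan power2_eq_square)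
  note h = zero_less_Suc this
  have H: "H \<in> carrier_mat ?d ?d" "H\<^sup>T = H" "H * H = 1\<^sub>m ?d"
    and Hinv: "\<And>x. x \<in> carrier_vec ?d \<Longrightarrow> H *\<^sub>v (H *\<^sub>v x) = x"
    unfolding H_def using householder_involution[OF h] householder_square[OF h]
    by (auto simp: transpose_householder)
  have He: "H *\<^sub>v unit_vec ?d 0 = v"
    unfolding H_def using householder_unit_vec[OF h] v(1) by (simp add: vec_eq_iff carrier_vecD)
  then have Hv: "H *\<^sub>v v = unit_vec ?d 0" using Hinv[of "unit_vec ?d 0"] by simp
  define C where "C = H * A * H"
  have C: "C \<in> carrier_mat ?d ?d" using H A by (simp add: C_def)
  have CT: "C\<^sup>T = C"
    unfolding C_def using H A sym
    by (simp add: transpose_mult[of _ ?d ?d _ ?d] assoc_mult_mat[of _ ?d ?d _ ?d _ ?d])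
  have Cmv: "C *\<^sub>v x = H *\<^sub>v (A *\<^sub>v (H *\<^sub>v x))" if "x \<in> carrier_vec ?d" for x
    unfolding C_def using H A that by (simp add: assoc_mult_mat_vec[of _ ?d ?d _ ?d])
  have Ce: "C *\<^sub>v unit_vec ?d 0 = e \<cdot>\<^sub>v unit_vec ?d 0"
    using Cmv[of "unit_vec ?d 0"] He ev Hv mult_mat_vec[OF H(1) v(1)] by simp
  have col: "C $$ (i, 0) = (if i = 0 then e else 0)" if "i < ?d" for i
  proof -
    have "(C *\<^sub>v unit_vec ?d 0) $ i = C $$ (i, 0)" using that C by simp
    then show ?thesis unfolding Ce using that by (cases "i = 0") simp_all
  qed
  have row: "C $$ (0, i) = (if i = 0 then e else 0)" if "i < ?d" for i
    using col[OF that] arg_cong[OF CT, of "\<lambda>M. M $$ (0, i)"] C that by (auto split: if_splits)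
  define A' where "A' = Matrix.mat n n (\<lambda>(i, j). C $$ (Suc i, Suc j))"
  have A': "A' \<in> carrier_mat n n" by (simp add: A'_def)
  have A'T: "A'\<^sup>T = A'"
  proof (intro eq_matI)
    fix i j assume "i < dim_row A'" "j < dim_col A'"
    then show "A'\<^sup>T $$ (i, j) = A' $$ (i, j)"
      using arg_cong[OF CT, of "\<lambda>M. M $$ (Suc i, Suc j)"] C by (simp add: A'_def)
  qed (auto simp: A'_def)
  have block: "C = four_block_mat (Matrix.mat 1 1 (\<lambda>_. e)) (0\<^sub>m 1 n) (0\<^sub>m n 1) A'"
    by (intro eq_matI) (use C col row in \<open>auto simp: A'_def less_Suc_eq_0_disj\<close>)
  have "char_poly (Matrix.mat 1 1 (\<lambda>_. e)) = [:- e, 1:]"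
    by (simp add: char_poly_defs det_def signof_id)
  then have "char_poly C = [:- e, 1:] * char_poly A'"
    unfolding block using A' by (subst char_poly_four_block_zeros_col) auto
  moreover have "similar_mat A C"
  proof (rule similar_matI[of _ _ H H ?d])
    have "H * C * H = (H * H) * A * (H * H)"
      unfolding C_def using H(1) A by (simp add: assoc_mult_mat[of _ ?d ?d _ ?d _ ?d])
    then show "A = H * C * H" using H A by simp
  qed (use A C H in auto)
  ultimately have cp: "char_poly A = [:- e, 1:] * char_poly A'"
    using char_poly_similar by metis
  have "\<exists>w'\<in>carrier_vec n. w' \<bullet> w' = w \<bullet> w \<and> (A' *\<^sub>v w') \<bullet> (A' *\<^sub>v w') = (A *\<^sub>v w) \<bullet> (A *\<^sub>v w)"
    if w: "w \<in> carrier_vec ?d" "w \<bullet> v = 0" for w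
  proof -
    have isom: "(H *\<^sub>v x) \<bullet> (H *\<^sub>v y) = x \<bullet> y" if "x \<in> carrier_vec ?d" "y \<in> carrier_vec ?d" for x y
      using scalar_prod_symmetric_mat[OF H(1,2) that(1), of "H *\<^sub>v y"] Hinv[OF that(2)] H(1) that by simp
    define y where "y = H *\<^sub>v w"
    have y: "y \<in> carrier_vec ?d" using H w by (simp add: y_def)
    have "y $ 0 = y \<bullet> unit_vec ?d 0" using y by simp
    also have "\<dots> = 0" using isom[OF w(1) v(1)] Hv w(2) by (simp add: y_def)
    finally have y0: "y $ 0 = 0" .
    \<comment> \<open>The witness is the reflected vector without its vanishing first
      coordinate.\<close>
    let ?w = "Matrix.vec n (\<lambda>i. y $ Suc i)"
    have Cy: "C *\<^sub>v y \<in> carrier_vec ?d" using C y by simp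
    have Cy0: "(C *\<^sub>v y) $ 0 = 0"
      using C y y0 row by (simp add: scalar_prod_def sum.atLeast0_lessThan_Suc_shift del: sum.op_ivl_Suc)
    have CyS: "Matrix.vec n (\<lambda>i. (C *\<^sub>v y) $ Suc i) = A' *\<^sub>v ?w"
      by (intro eq_vecI) (use C y y0 in
        \<open>auto simp: A'_def scalar_prod_def sum.atLeast0_lessThan_Suc_shift simp del: sum.op_ivl_Suc\<close>)
    have "w \<bullet> w = ?w \<bullet> ?w"
      using isom[OF w(1) w(1)] scalar_prod_Suc[OF y y] y0 by (simp add: y_def)
    moreover have "(A *\<^sub>v w) \<bullet> (A *\<^sub>v w) = (C *\<^sub>v y) \<bullet> (C *\<^sub>v y)"
      using Cmv[OF y] Hinv[OF w(1)] isom[of "A *\<^sub>v w" "A *\<^sub>v w"] A w(1) by (simp add: y_def)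
    moreover have "\<dots> = (A' *\<^sub>v ?w) \<bullet> (A' *\<^sub>v ?w)"
      using scalar_prod_Suc[OF Cy Cy] Cy0 CyS by simp
    ultimately show ?thesis by (intro bexI[of _ ?w]) auto
  qed
  with A' A'T cp that show ?thesis by blast
qed

section \<open>Norm bounds for symmetric matrices from their eigenvalues\<close>

lemma scalar_prod_self_nonneg: "0 \<le> x \<bullet> x" for x :: "real vec"
  by (simp add: scalar_prod_def sum_nonneg)

lemma scalar_prod_self_pos:
  fixes x :: "real vec"
  assumes "x \<in> carrier_vec n" "x \<noteq> 0\<^sub>v n"
  shows "0 < x \<bullet> x"
proof -
  obtain i where "i < n" "x $ i \<noteq> 0" using assms by (auto simp: vec_eq_iff)
  then show ?thesis
    using assms(1) by (auto simp: scalar_prod_def intro!: sum_pos2[of _ i] simp: zero_less_mult_iff)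
qed

lemma orthogonal_decomposition:
  fixes v x :: "real vec"
  assumes v: "v \<in> carrier_vec n" "v \<bullet> v = 1" and x: "x \<in> carrier_vec n"
  obtains w where "w \<in> carrier_vec n" "w \<bullet> v = 0" "x = (x \<bullet> v) \<cdot>\<^sub>v v + w"
proof -
  let ?w = "x - (x \<bullet> v) \<cdot>\<^sub>v v"
  have "?w \<bullet> v = 0" using v x by (simp add: minus_scalar_prod_distrib[of _ n])
  moreover have "x = (x \<bullet> v) \<cdot>\<^sub>v v + ?w" using v x by (intro eq_vecI) auto
  ultimately show ?thesis using that[of ?w] v x by auto
qed

lemma scalar_prod_orthogonal_sum:
  fixes v w w' :: "real vec"
  assumes "v \<in> carrier_vec n" "v \<bullet> v = 1" "w \<in> carrier_vec n" "w' \<in> carrier_vec n"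
    "w \<bullet> v = 0" "w' \<bullet> v = 0"
  shows "(a \<cdot>\<^sub>v v + w) \<bullet> (b \<cdot>\<^sub>v v + w') = a * b + w \<bullet> w'"
  using assms comm_scalar_prod[of v n w']
  by (simp add: add_scalar_prod_distrib[of _ n] scalar_prod_add_distrib[of _ n])

text \<open>Induction on the dimension takes the place of an orthonormal eigenbasis: a root from
  \<open>es\<close> gives a unit eigenvector, deflation removes it, and the two contributions add up
  by Pythagoras. Since the characteristic polynomial is given in linear factors over the reals, a
  real eigenvalue is at hand at every stage.\<close>

lemma symmetric_mat_norm_bound:
  fixes A :: "real mat"
  assumes "A \<in> carrier_mat n n" "A\<^sup>T = A" "char_poly A = (\<Prod>e\<leftarrow>es. [:- e, 1:])"
    "\<forall>e\<in>set es. \<bar>e\<bar> \<le> M" "x \<in> carrier_vec n"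
  shows "(A *\<^sub>v x) \<bullet> (A *\<^sub>v x) \<le> M\<^sup>2 * (x \<bullet> x)"
  using assms
proof (induction n arbitrary: A es x)
  case 0
  then show ?case by (simp add: scalar_prod_def)
next
  case (Suc n)
  note A = Suc.prems(1) and sym = Suc.prems(2) and x = Suc.prems(5)
  \<comment> \<open>The empty product has degree 0, so \<open>es\<close> cannot be empty.\<close>
  have "degree (char_poly A) = Suc n" using degree_monic_char_poly[OF A] by simp
  then obtain e es' where es: "es = e # es'" using Suc.prems(3) by (cases es) auto
  have "poly (char_poly A) e = 0" unfolding Suc.prems(3) es by simp
  then obtain u where "eigenvector A u e" using eigenvalue_root_char_poly[OF A] by (auto simp: eigenvalue_def)
  then have u: "u \<in> carrier_vec (Suc n)" "u \<noteq> 0\<^sub>v (Suc n)" "A *\<^sub>v u = e \<cdot>\<^sub>v u"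
    using A by (auto simp: eigenvector_def)
  have pos: "u \<bullet> u > 0" by (rule scalar_prod_self_pos[OF u(1,2)])
  define v where "v = (1 / sqrt (u \<bullet> u)) \<cdot>\<^sub>v u"
  have v: "v \<in> carrier_vec (Suc n)" using u by (simp add: v_def)
  have vv: "v \<bullet> v = 1" using pos by (simp add: v_def)
  have Av: "A *\<^sub>v v = e \<cdot>\<^sub>v v"
    using mult_mat_vec[OF A u(1)] u(3) by (simp add: v_def smult_smult_assoc mult.commute)
  obtain A' where A': "A' \<in> carrier_mat n n" "A'\<^sup>T = A'" "char_poly A = [:- e, 1:] * char_poly A'"
    and A'w: "\<And>w. w \<in> carrier_vec (Suc n) \<Longrightarrow> w \<bullet> v = 0 \<Longrightarrow>
       \<exists>w'\<in>carrier_vec n. w' \<bullet> w' = w \<bullet> w \<and> (A' *\<^sub>v w') \<bullet> (A' *\<^sub>v w') = (A *\<^sub>v w) \<bullet> (A *\<^sub>v w)"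
    using eigenvector_deflation[OF A sym v vv Av] by metis
  have "[:- e, 1:] * char_poly A' = [:- e, 1:] * (\<Prod>e\<leftarrow>es'. [:- e, 1:])"
    using A'(3) Suc.prems(3) es by simp
  then have cp: "char_poly A' = (\<Prod>e\<leftarrow>es'. [:- e, 1:])"
    using mult_left_cancel[of "[:- e, 1:]"] by (metis pCons_eq_0_iff zero_neq_one)
  obtain w where w: "w \<in> carrier_vec (Suc n)" "w \<bullet> v = 0" and xw: "x = (x \<bullet> v) \<cdot>\<^sub>v v + w"
    using orthogonal_decomposition[OF v vv x] by metis
  let ?c = "x \<bullet> v"
  have Aw: "A *\<^sub>v w \<in> carrier_vec (Suc n)" using A w by simp
  have Awv: "(A *\<^sub>v w) \<bullet> v = 0"
    using scalar_prod_symmetric_mat[OF A sym w(1) v] Av w v by simp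
  have "(A *\<^sub>v w) \<bullet> (A *\<^sub>v w) \<le> M\<^sup>2 * (w \<bullet> w)"
    using A'w[OF w] Suc.IH[OF A'(1,2) cp] Suc.prems(4) es by fastforce
  moreover have "e\<^sup>2 \<le> M\<^sup>2" using Suc.prems(4) es by (intro abs_le_square_iff[THEN iffD1]) auto
  then have "?c\<^sup>2 * e\<^sup>2 \<le> ?c\<^sup>2 * M\<^sup>2" by (intro mult_left_mono) auto
  moreover have "A *\<^sub>v x = (?c * e) \<cdot>\<^sub>v v + A *\<^sub>v w"
    using mult_add_distrib_mat_vec[OF A smult_carrier_vec[THEN iffD2, OF v] w(1), of ?c] mult_mat_vec[OF A v, of ?c] Av xw
    by (simp add: smult_smult_assoc)
  then have "(A *\<^sub>v x) \<bullet> (A *\<^sub>v x) = ?c\<^sup>2 * e\<^sup>2 + (A *\<^sub>v w) \<bullet> (A *\<^sub>v w)"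
    using scalar_prod_orthogonal_sum[OF v vv Aw Aw Awv Awv, of "?c * e" "?c * e"]
    by (simp add: power2_eq_square mult_ac)
  moreover have "x \<bullet> x = ?c\<^sup>2 + w \<bullet> w"
    using scalar_prod_orthogonal_sum[OF v vv w(1,1,2,2), of ?c ?c] xw by (simp add: power2_eq_square)
  ultimately show ?case by (simp add: algebra_simps)
qed

text \<open>Deflating at the given \<open>v\<close> cancels the factor of \<open>e\<close>, so the
  remaining block has exactly the roots \<open>es\<close> and the unrestricted bound applies to
  it.\<close>

lemma symmetric_mat_norm_bound_orthogonal:
  fixes A :: "real mat"
  assumes A: "A \<in> carrier_mat n n" "A\<^sup>T = A" "char_poly A = [:- e, 1:] * (\<Prod>e\<leftarrow>es. [:- e, 1:])"
    and M: "\<forall>e\<in>set es. \<bar>e\<bar> \<le> M"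
    and v: "v \<in> carrier_vec n" "v \<bullet> v = 1" "A *\<^sub>v v = e \<cdot>\<^sub>v v"
    and w: "w \<in> carrier_vec n" "w \<bullet> v = 0"
  shows "(A *\<^sub>v w) \<bullet> (A *\<^sub>v w) \<le> M\<^sup>2 * (w \<bullet> w)"
proof -
  have "n \<noteq> 0" using v(1,2) by (intro notI) (simp add: scalar_prod_def)
  then obtain m where m: "n = Suc m" by (cases n) auto
  obtain A' where A': "A' \<in> carrier_mat m m" "A'\<^sup>T = A'" "char_poly A = [:- e, 1:] * char_poly A'"
    and A'w: "\<exists>w'\<in>carrier_vec m. w' \<bullet> w' = w \<bullet> w \<and> (A' *\<^sub>v w') \<bullet> (A' *\<^sub>v w') = (A *\<^sub>v w) \<bullet> (A *\<^sub>v w)"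
    using eigenvector_deflation[OF A(1)[unfolded m] A(2) v(1)[unfolded m] v(2,3)] w[unfolded m] by metis
  have "char_poly A' = (\<Prod>e\<leftarrow>es. [:- e, 1:])"
    using mult_left_cancel[of "[:- e, 1:]"] A'(3) A(3) by (metis pCons_eq_0_iff zero_neq_one)
  from A'w symmetric_mat_norm_bound[OF A'(1,2) this M] show ?thesis by metis
qed

section \<open>Power iteration\<close>

text \<open>The spectral information is condensed into \<open>orth_bound\<close>, with
  \<open>M\<close> in the role of the second eigenvalue. Equality of \<open>M\<close> and \<mu> is
  permitted here; strict inequality enters only with convergence.\<close>

locale power_method =
  fixes B :: "real mat" and d :: nat and \<mu> M :: real and v :: "real vec"
  assumes B: "B \<in> carrier_mat d d" and sym: "B\<^sup>T = B"
    and psd: "\<And>x. x \<in> carrier_vec d \<Longrightarrow> 0 \<le> x \<bullet> (B *\<^sub>v x)"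
    and v: "v \<in> carrier_vec d" "v \<bullet> v = 1" "B *\<^sub>v v = \<mu> \<cdot>\<^sub>v v"
    and M: "0 < M" "M \<le> \<mu>"
    and orth_bound: "\<And>w. w \<in> carrier_vec d \<Longrightarrow> w \<bullet> v = 0 \<Longrightarrow> (B *\<^sub>v w) \<bullet> (B *\<^sub>v w) \<le> M\<^sup>2 * (w \<bullet> w)"
begin

text \<open>Expanding the nonnegative square of \<open>M w - B w\<close> bounds twice
  \<open>M\<close> times the quadratic form by the sum of two terms, each at most
  \<open>M^2 (w . w)\<close> by \<open>orth_bound\<close>.\<close>

lemma quadratic_form_le:
  assumes w: "w \<in> carrier_vec d" "w \<bullet> v = 0"
  shows "w \<bullet> (B *\<^sub>v w) \<le> M * (w \<bullet> w)"
proof -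
  let ?u = "B *\<^sub>v w"
  have u: "?u \<in> carrier_vec d" using B w by simp
  have "0 \<le> (M \<cdot>\<^sub>v w - ?u) \<bullet> (M \<cdot>\<^sub>v w - ?u)" by (rule scalar_prod_self_nonneg)
  also have "\<dots> = M\<^sup>2 * (w \<bullet> w) - 2 * M * (w \<bullet> ?u) + ?u \<bullet> ?u"
    using w u comm_scalar_prod[OF u w(1)]
    by (simp add: minus_scalar_prod_distrib[of _ d] scalar_prod_minus_distrib[of _ d] power2_eq_square algebra_simps)
  finally have "M * (w \<bullet> ?u) \<le> M * (M * (w \<bullet> w))"
    using orth_bound[OF w] by (simp add: power2_eq_square)
  then show ?thesis using M by simp
qed

text \<open>\<open>B\<close> respects the splitting into the line of \<open>v\<close> and its
  complement, because \<open>v\<close> is an eigenvector and \<open>B\<close> is symmetric. Each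
  step multiplies the first part by \<mu> and the squared length of the second by at most
  \<open>M^2\<close>.\<close>

lemma funpow_decomposition:
  assumes x: "x \<in> carrier_vec d"
  shows "\<exists>w\<in>carrier_vec d. w \<bullet> v = 0 \<and> ((\<lambda>y. B *\<^sub>v y) ^^ q) x = ((x \<bullet> v) * \<mu> ^ q) \<cdot>\<^sub>v v + w
    \<and> w \<bullet> w \<le> M ^ (2 * q) * (x \<bullet> x - (x \<bullet> v)\<^sup>2)"
proof (induction q)
  case 0
  obtain w where w: "w \<in> carrier_vec d" "w \<bullet> v = 0" and xw: "x = (x \<bullet> v) \<cdot>\<^sub>v v + w"
    using orthogonal_decomposition[OF v(1,2) x] by metis
  have "x \<bullet> x = (x \<bullet> v)\<^sup>2 + w \<bullet> w"
    using scalar_prod_orthogonal_sum[OF v(1,2) w(1,1,2,2), of "x \<bullet> v" "x \<bullet> v"] xw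
    by (simp add: power2_eq_square)
  then show ?case using w xw by auto
next
  case (Suc q)
  then obtain w where w: "w \<in> carrier_vec d" "w \<bullet> v = 0"
    and eq: "((\<lambda>y. B *\<^sub>v y) ^^ q) x = ((x \<bullet> v) * \<mu> ^ q) \<cdot>\<^sub>v v + w"
    and le: "w \<bullet> w \<le> M ^ (2 * q) * (x \<bullet> x - (x \<bullet> v)\<^sup>2)" by auto
  have "(B *\<^sub>v w) \<bullet> v = 0"
    using scalar_prod_symmetric_mat[OF B sym w(1) v(1)] v w by simp
  moreover have "((\<lambda>y. B *\<^sub>v y) ^^ Suc q) x = ((x \<bullet> v) * \<mu> ^ Suc q) \<cdot>\<^sub>v v + B *\<^sub>v w"
    using mult_add_distrib_mat_vec[OF B smult_carrier_vec[THEN iffD2, OF v(1)] w(1)] mult_mat_vec[OF B v(1)] v(3) eq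
    by (simp add: smult_smult_assoc mult_ac)
  moreover have "(B *\<^sub>v w) \<bullet> (B *\<^sub>v w) \<le> M ^ (2 * Suc q) * (x \<bullet> x - (x \<bullet> v)\<^sup>2)"
    using order_trans[OF orth_bound[OF w] mult_left_mono[OF le]]
    by (simp add: power2_eq_square mult_ac)
  ultimately show ?case using B w by (intro bexI[of _ "B *\<^sub>v w"]) auto
qed

text \<open>The component along \<open>v\<close> never vanishes, so no normalisation in the
  iteration divides by zero.\<close>

lemma funpow_nonzero:
  assumes "x \<in> carrier_vec d" "x \<bullet> v \<noteq> 0"
  shows "0 < ((\<lambda>y. B *\<^sub>v y) ^^ q) x \<bullet> ((\<lambda>y. B *\<^sub>v y) ^^ q) x"
proof -
  obtain w where w: "w \<in> carrier_vec d" "w \<bullet> v = 0"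
    and eq: "((\<lambda>y. B *\<^sub>v y) ^^ q) x = ((x \<bullet> v) * \<mu> ^ q) \<cdot>\<^sub>v v + w"
    using funpow_decomposition[OF assms(1), of q] by metis
  have "(x \<bullet> v) * \<mu> ^ q \<noteq> 0" using assms M by simp
  then have "0 < ((x \<bullet> v) * \<mu> ^ q) * ((x \<bullet> v) * \<mu> ^ q)" by (metis not_real_square_gt_zero)
  then show ?thesis
    unfolding eq scalar_prod_orthogonal_sum[OF v(1,2) w(1,1,2,2)]
    using scalar_prod_self_nonneg[of w] by linarith
qed

text \<open>Normalisation ignores positive factors, so the intermediate ones can be postponed to a
  single one at the end.\<close>

lemma power_iterate_eq:
  assumes x: "x \<in> carrier_vec d" "x \<bullet> x = 1" "x \<bullet> v \<noteq> 0"
  shows "power_iterate B x q = normalize_vec (((\<lambda>y. B *\<^sub>v y) ^^ q) x)"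
proof (induction q)
  case 0
  then show ?case using x by (simp add: normalize_vec_def vnorm_def)
next
  case (Suc q)
  let ?z = "((\<lambda>y. B *\<^sub>v y) ^^ q) x"
  have z: "?z \<in> carrier_vec d" using x(1) B by (induction q) auto
  have pos: "0 < vnorm ?z" using funpow_nonzero[OF x(1,3)] by (simp add: vnorm_def)
  have Bz: "B *\<^sub>v normalize_vec ?z = (1 / vnorm ?z) \<cdot>\<^sub>v (B *\<^sub>v ?z)"
    unfolding normalize_vec_def using mult_mat_vec[OF B z] by simp
  have "normalize_vec (a \<cdot>\<^sub>v y) = normalize_vec y" if "0 < a" for a and y :: "real vec"
  proof -
    have "vnorm (a \<cdot>\<^sub>v y) = a * vnorm y"
      using that by (simp add: vnorm_def real_sqrt_mult flip: mult.assoc)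
    then show ?thesis using that by (simp add: normalize_vec_def smult_smult_assoc)
  qed
  then show ?case using Suc pos Bz by simp
qed

lemma rayleigh_pow_eq:
  assumes x: "x \<in> carrier_vec d" "x \<bullet> x = 1" "x \<bullet> v \<noteq> 0"
  defines "z \<equiv> \<lambda>q. ((\<lambda>y. B *\<^sub>v y) ^^ q) x"
  shows "rayleigh_pow B x q = (z q \<bullet> (B *\<^sub>v z q)) / (z q \<bullet> z q)"
proof -
  have z: "z q \<in> carrier_vec d" unfolding z_def using x(1) B by (induction q) auto
  have pos: "0 < z q \<bullet> z q" unfolding z_def by (rule funpow_nonzero[OF x(1,3)])
  have "power_iterate B x q = (1 / vnorm (z q)) \<cdot>\<^sub>v z q"
    unfolding power_iterate_eq[OF x] normalize_vec_def z_def ..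
  then show ?thesis
    unfolding rayleigh_pow_def using z B pos mult_mat_vec[OF B z] by (simp add: vnorm_def)
qed

text \<open>The part along \<open>v\<close> contributes nothing to the gap, whose numerator is \<mu>
  \<open>(w . w)\<close> minus the quadratic form at \<open>w\<close>. This lies between 0 and \<mu>
  \<open>(w . w)\<close> by \<open>quadratic_form_le\<close> and \<open>psd\<close>; dropping
  \<open>w . w\<close> from the denominator and inserting the decay of \<open>w\<close> gives the
  upper bound.\<close>

lemma rayleigh_pow_bounds:
  assumes x: "x \<in> carrier_vec d" "x \<bullet> x = 1" "x \<bullet> v \<noteq> 0"
  shows "0 \<le> \<mu> - rayleigh_pow B x q"
    and "\<mu> - rayleigh_pow B x q \<le> \<mu> * (M / \<mu>) ^ (2 * q) * ((1 - (x \<bullet> v)\<^sup>2) / (x \<bullet> v)\<^sup>2)"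
proof -
  let ?c = "x \<bullet> v"
  let ?z = "((\<lambda>y. B *\<^sub>v y) ^^ q) x"
  obtain w where w: "w \<in> carrier_vec d" "w \<bullet> v = 0" and eq: "?z = (?c * \<mu> ^ q) \<cdot>\<^sub>v v + w"
    and le: "w \<bullet> w \<le> M ^ (2 * q) * (1 - ?c\<^sup>2)"
    using funpow_decomposition[OF x(1), of q] x(2) by metis
  \<comment> \<open>This is the squared length of the component of the unnormalised iterate along
    \<open>v\<close>.\<close>
  define S where "S = ?c\<^sup>2 * \<mu> ^ (2 * q)"
  have S: "S > 0" using x M by (simp add: S_def)
  have Bw: "B *\<^sub>v w \<in> carrier_vec d" "(B *\<^sub>v w) \<bullet> v = 0"
    using B w scalar_prod_symmetric_mat[OF B sym w(1) v(1)] v by simp_all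
  have "B *\<^sub>v ?z = (\<mu> * (?c * \<mu> ^ q)) \<cdot>\<^sub>v v + B *\<^sub>v w"
    unfolding eq
    using mult_add_distrib_mat_vec[OF B smult_carrier_vec[THEN iffD2, OF v(1)] w(1)] mult_mat_vec[OF B v(1)] v(3)
    by (simp add: smult_smult_assoc mult_ac)
  then have zBz: "?z \<bullet> (B *\<^sub>v ?z) = \<mu> * S + w \<bullet> (B *\<^sub>v w)"
    using scalar_prod_orthogonal_sum[OF v(1,2) w(1) Bw(1) w(2) Bw(2)]
    by (simp add: eq S_def power2_eq_square power_mult_distrib power_mult mult_ac)
  have zz: "?z \<bullet> ?z = S + w \<bullet> w"
    using scalar_prod_orthogonal_sum[OF v(1,2) w(1,1,2,2)]
    by (simp add: eq S_def power2_eq_square power_mult power_mult_distrib mult_ac)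
  have w0: "0 \<le> w \<bullet> w" by (rule scalar_prod_self_nonneg)
  have gap: "\<mu> - rayleigh_pow B x q = (\<mu> * (w \<bullet> w) - w \<bullet> (B *\<^sub>v w)) / (S + w \<bullet> w)"
    unfolding rayleigh_pow_eq[OF x] zBz zz using S w0 by (simp add: field_simps)
  have "w \<bullet> (B *\<^sub>v w) \<le> \<mu> * (w \<bullet> w)"
    using quadratic_form_le[OF w] mult_right_mono[OF M(2) w0] by linarith
  then show "0 \<le> \<mu> - rayleigh_pow B x q" unfolding gap using S w0 by simp
  have "\<mu> - rayleigh_pow B x q \<le> (\<mu> * (w \<bullet> w)) / S"
    unfolding gap using psd[OF w(1)] S w0 M by (intro frac_le) auto
  also have "\<dots> \<le> (\<mu> * (M ^ (2 * q) * (1 - ?c\<^sup>2))) / S"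
    using le M S by (intro divide_right_mono mult_left_mono) auto
  also have "\<dots> = \<mu> * (M / \<mu>) ^ (2 * q) * ((1 - ?c\<^sup>2) / ?c\<^sup>2)"
    by (simp add: S_def power_divide mult.commute mult.left_commute)
  finally show "\<mu> - rayleigh_pow B x q \<le> \<mu> * (M / \<mu>) ^ (2 * q) * ((1 - ?c\<^sup>2) / ?c\<^sup>2)" .
qed

end

section \<open>From the T-eigenvalues to the assumptions of the power method\<close>

lemma monic_eq_prod_proots:
  fixes p :: "'a :: idom poly"
  assumes "proots p = mset es" "degree p = length es" "lead_coeff p = 1"
  shows "p = (\<Prod>e\<leftarrow>es. [:- e, 1:])"
  using assms
proof (induction es arbitrary: p)
  case Nil
  then show ?case by (auto elim!: degree_eq_zeroE)
next
  case (Cons e es)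
  have p0: "p \<noteq> 0" using Cons.prems(3) by auto
  have "e \<in># proots p" using Cons.prems(1) by simp
  then have "poly p e = 0" using p0 by simp
  then obtain q where q: "p = [:- e, 1:] * q" by (auto simp: poly_eq_0_iff_dvd)
  have q0: "q \<noteq> 0" using p0 q by auto
  have "proots p = proots [:- e, 1:] + proots q"
    unfolding q using q0 by (intro proots_mult) auto
  then have "proots q = mset es" using Cons.prems(1) by simp
  moreover have "degree p = Suc (degree q)" unfolding q using q0 by (subst degree_mult_eq) auto
  then have "degree q = length es" using Cons.prems(2) by simp
  moreover have "lead_coeff q = 1" using Cons.prems(3) unfolding q lead_coeff_mult by simp
  ultimately show ?case using Cons.IH q by simp
qed

text \<open>The multiset of T-eigenvalues has as many elements as the degree, so the characteristic
  polynomial splits over the reals. After the factor for \<open>lam 1\<close> is set aside,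
  monotonicity and positivity place all other roots between 0 and \<open>lam 2\<close>.\<close>

lemma T_SPD_power_method:
  assumes A: "T_SPD n p A" and d: "d = n * p" "2 \<le> d"
    and lam: "image_mset lam (mset_set {1..d}) = T_eigenvalues n p A"
    and gap: "lam 2 < lam 1" and decr: "\<forall>i\<in>{2..<d}. lam (Suc i) \<le> lam i" and pos: "0 < lam d"
    and v: "eigenvector (bcirc n p A) v (lam 1)" "vnorm v = 1"
  shows "power_method (bcirc n p A) d (lam 1) (lam 2) v"
proof -
  let ?B = "bcirc n p A"
  have B: "?B \<in> carrier_mat d d" by (simp add: bcirc_def d)
  have sym: "?B\<^sup>T = ?B" and pd: "\<And>x. x \<in> carrier_vec d \<Longrightarrow> x \<noteq> 0\<^sub>v d \<Longrightarrow> 0 < x \<bullet> (?B *\<^sub>v x)"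
    using A B unfolding T_SPD_def sym_pos_def_def by auto
  have v': "v \<in> carrier_vec d" "v \<bullet> v = 1" "?B *\<^sub>v v = lam 1 \<cdot>\<^sub>v v"
    using v B by (auto simp: eigenvector_def vnorm_def)
  \<comment> \<open>The ordering is assumed between neighbours only; it is chained upwards from 2
    here and downwards from \<open>d\<close> below.\<close>
  have upper: "lam i \<le> lam 2" if "2 \<le> i" "i \<le> d" for i
    using that by (induction i rule: dec_induct) (use decr in force)+
  have lower: "lam d \<le> lam i" if "2 \<le> i" "i \<le> d" for i
    using that(2,1) by (induction i rule: inc_induct) (use decr in force)+
  let ?es = "map lam [2..<Suc d]"
  have "[1..<Suc d] = 1 # [2..<Suc d]" using d(2) by (simp add: upt_conv_Cons numeral_2_eq_2)
  then have "mset (lam 1 # ?es) = image_mset lam (mset [1..<Suc d])" by simp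
  also have "mset [1..<Suc d] = mset_set {1..d}"
    unfolding mset_upt by (simp add: atLeastLessThanSuc_atLeastAtMost)
  finally have "proots (char_poly ?B) = mset (lam 1 # ?es)"
    using lam by (simp add: T_eigenvalues_def)
  moreover have "degree (char_poly ?B) = length (lam 1 # ?es)" "lead_coeff (char_poly ?B) = 1"
    using degree_monic_char_poly[OF B] d(2) by auto
  ultimately have "char_poly ?B = (\<Prod>e\<leftarrow>lam 1 # ?es. [:- e, 1:])" by (rule monic_eq_prod_proots)
  then have cp: "char_poly ?B = [:- lam 1, 1:] * (\<Prod>e\<leftarrow>?es. [:- e, 1:])" by simp
  have es: "\<forall>e\<in>set ?es. \<bar>e\<bar> \<le> lam 2"
    using upper lower pos by (fastforce simp: abs_le_iff)
  show ?thesis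
  proof
    show "0 \<le> x \<bullet> (?B *\<^sub>v x)" if "x \<in> carrier_vec d" for x
      using pd[OF that] B by (cases "x = 0\<^sub>v d") auto
    show "0 < lam 2" using lower[of 2] d(2) pos by auto
    show "lam 2 \<le> lam 1" using gap by simp
    show "(?B *\<^sub>v w) \<bullet> (?B *\<^sub>v w) \<le> (lam 2)\<^sup>2 * (w \<bullet> w)" if "w \<in> carrier_vec d" "w \<bullet> v = 0" for w
      by (rule symmetric_mat_norm_bound_orthogonal[OF B sym cp es v' that])
  qed (fact B sym v')+
qed

section \<open>Lebesgue measure of cones in the unit ball\<close>

abbreviation lborel_on :: "nat set \<Rightarrow> (nat \<Rightarrow> real) measure" where
  "lborel_on I \<equiv> Pi\<^sub>M I (\<lambda>_. lborel)"

interpretation lborel_on: product_sigma_finite "\<lambda>_::nat. lborel :: real measure" ..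

text \<open>Fubini isolates coordinate \<open>i\<close>. With the others fixed, \<open>f\<close> is
  a constant by \<open>f_upd\<close>, so the substitution is affine on the line with factor
  \<open>c\<close>.\<close>

lemma nn_integral_coordinate_affine:
  assumes I: "finite I" "i \<in> I" and c: "c \<noteq> 0"
    and f [measurable]: "f \<in> borel_measurable (lborel_on I)"
    and f_upd: "\<And>x t. f (x(i := t)) = f x"
    and g [measurable]: "g \<in> borel_measurable (lborel_on I)"
  shows "(\<integral>\<^sup>+x. g x \<partial>lborel_on I) = ennreal \<bar>c\<bar> * (\<integral>\<^sup>+x. g (x(i := c * x i + f x)) \<partial>lborel_on I)"
proof -
  define J where "J = I - {i}"
  have J: "finite J" "i \<notin> J" "I = insert i J" using I by (auto simp: J_def)
  have comp: "(\<lambda>x. x i) \<in> borel_measurable (lborel_on I)"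
    using measurable_component_singleton[of i I "\<lambda>_. lborel"] I by simp
  have T: "(\<lambda>x. x(i := c * x i + f x)) \<in> measurable (lborel_on I) (lborel_on I)"
    by (rule measurable_fun_upd[where J = I]) (use I comp in auto)
  have gT: "(\<lambda>x. g (x(i := c * x i + f x))) \<in> borel_measurable (lborel_on I)"
    by (rule measurable_compose[OF T g])
  have "(\<integral>\<^sup>+x. g x \<partial>lborel_on I) = (\<integral>\<^sup>+x. \<integral>\<^sup>+y. g (x(i := y)) \<partial>lborel \<partial>lborel_on J)"
    using lborel_on.product_nn_integral_insert[OF J(1,2), of g] g by (simp add: J(3))
  also have "\<dots> = (\<integral>\<^sup>+x. ennreal \<bar>c\<bar> * (\<integral>\<^sup>+y. g (x(i := c * y + f x)) \<partial>lborel) \<partial>lborel_on J)"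
  proof (rule nn_integral_cong)
    fix x assume x: "x \<in> space (lborel_on J)"
    have "(\<lambda>y. x(i := y)) \<in> measurable lborel (lborel_on I)"
      by (rule measurable_fun_upd[where J = J]) (use J x in auto)
    then have "(\<lambda>y. g (x(i := y))) \<in> borel_measurable borel"
      using measurable_compose[OF _ g] by force
    from nn_integral_real_affine[OF this c, of "f x"]
    show "(\<integral>\<^sup>+y. g (x(i := y)) \<partial>lborel) = ennreal \<bar>c\<bar> * (\<integral>\<^sup>+y. g (x(i := c * y + f x)) \<partial>lborel)"
      by (simp add: add.commute)
  qed
  \<comment> \<open>The integrand is rewritten as a function of \<open>x(i := y)\<close> alone, so
    that Fubini can be applied backwards.\<close>
  also have "\<dots> = (\<integral>\<^sup>+x. ennreal \<bar>c\<bar> * (\<integral>\<^sup>+y. g ((x(i := y))(i := c * (x(i := y)) i + f (x(i := y)))) \<partial>lborel) \<partial>lborel_on J)"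
    by (simp add: f_upd)
  also have "\<dots> = ennreal \<bar>c\<bar> * (\<integral>\<^sup>+x. (\<integral>\<^sup>+y. g ((x(i := y))(i := c * (x(i := y)) i + f (x(i := y)))) \<partial>lborel) \<partial>lborel_on J)"
  proof (rule nn_integral_cmult)
    have "(\<lambda>p. g (((fst p)(i := snd p))(i := c * ((fst p)(i := snd p)) i + f ((fst p)(i := snd p)))))
        \<in> borel_measurable (lborel_on J \<Otimes>\<^sub>M lborel)"
      by (rule measurable_compose[OF measurable_fun_upd[where J = J] gT]) (use J in auto)
    from lborel.borel_measurable_nn_integral_fst[OF this]
    show "(\<lambda>x. \<integral>\<^sup>+y. g ((x(i := y))(i := c * (x(i := y)) i + f (x(i := y)))) \<partial>lborel) \<in> borel_measurable (lborel_on J)"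
      by simp
  qed
  also have "(\<integral>\<^sup>+x. (\<integral>\<^sup>+y. g ((x(i := y))(i := c * (x(i := y)) i + f (x(i := y)))) \<partial>lborel) \<partial>lborel_on J)
      = (\<integral>\<^sup>+x. g (x(i := c * x i + f x)) \<partial>lborel_on I)"
    using lborel_on.product_nn_integral_insert[OF J(1,2), of "\<lambda>x. g (x(i := c * x i + f x))"] gT
    by (simp add: J(3))
  finally show ?thesis .
qed

lemma measurable_coordinate [measurable]:
  "i \<in> I \<Longrightarrow> (\<lambda>x. x i) \<in> borel_measurable (lborel_on I)"
  using measurable_component_singleton[of i I "\<lambda>_. lborel"] by simp

lemma measurable_fun_upd_lborel_on:
  assumes "i \<in> I" "h \<in> borel_measurable (lborel_on I)"
  shows "(\<lambda>x. x(i := h x)) \<in> measurable (lborel_on I) (lborel_on I)"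
  by (rule measurable_fun_upd[where J = I]) (use assms in auto)

text \<open>The set \<open>J\<close> of affected coordinates is a parameter so that the shear can be
  built up one coordinate at a time. For 0 outside \<open>J\<close>, negating \<open>a\<close> gives
  the inverse.\<close>

definition column_shear :: "nat set \<Rightarrow> (nat \<Rightarrow> real) \<Rightarrow> (nat \<Rightarrow> real) \<Rightarrow> nat \<Rightarrow> real" where
  "column_shear J a x = (\<lambda>k. if k \<in> J then x k + a k * x 0 else x k)"

text \<open>Each coordinate in \<open>J\<close> is translated by an amount that depends on
  coordinate 0 only, which the shear leaves alone; every such step has factor 1.\<close>

lemma nn_integral_column_shear:
  assumes "finite I" "0 \<in> I" "J \<subseteq> I - {0}" "g \<in> borel_measurable (lborel_on I)"
  shows "(\<integral>\<^sup>+x. g (column_shear J a x) \<partial>lborel_on I) = (\<integral>\<^sup>+x. g x \<partial>lborel_on I)"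
proof -
  have "finite J" using assms(1,3) finite_subset by blast
  then show ?thesis using assms(3,4)
  proof (induction J arbitrary: g rule: finite_induct)
    case empty
    then show ?case by (simp add: column_shear_def)
  next
    case (insert i J)
    let ?T = "\<lambda>x::nat\<Rightarrow>real. x(i := 1 * x i + a i * x 0)"
    have i: "i \<in> I" "i \<noteq> 0" using insert by auto
    have T: "?T \<in> measurable (lborel_on I) (lborel_on I)"
      using i(1) assms(2) by (intro measurable_fun_upd_lborel_on) auto
    have "column_shear (insert i J) a x = ?T (column_shear J a x)" for x
      using insert i by (auto simp: column_shear_def)
    then have "(\<integral>\<^sup>+x. g (column_shear (insert i J) a x) \<partial>lborel_on I)
        = (\<integral>\<^sup>+x. g (?T (column_shear J a x)) \<partial>lborel_on I)" by simp
    also have "\<dots> = (\<integral>\<^sup>+x. g (?T x) \<partial>lborel_on I)"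
      using insert.prems by (intro insert.IH measurable_compose[OF T]) auto
    also have "\<dots> = (\<integral>\<^sup>+x. g x \<partial>lborel_on I)"
      using nn_integral_coordinate_affine[OF assms(1) i(1), of 1 "\<lambda>x. a i * x 0" g] i insert.prems assms(2)
      by simp
    finally show ?case .
  qed
qed

lemma nn_integral_scale:
  assumes "finite I" "J \<subseteq> I" "0 < c" "g \<in> borel_measurable (lborel_on I)"
  shows "(\<integral>\<^sup>+x. g x \<partial>lborel_on I)
    = ennreal (c ^ card J) * (\<integral>\<^sup>+x. g (\<lambda>k. if k \<in> J then c * x k else x k) \<partial>lborel_on I)"
proof -
  have "finite J" using assms(1,2) finite_subset by blast
  then show ?thesis using assms(2,4)
  proof (induction J arbitrary: g rule: finite_induct)
    case empty
    then show ?case by simp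
  next
    case (insert i J)
    let ?S = "\<lambda>J (x::nat\<Rightarrow>real). \<lambda>k. if k \<in> J then c * x k else x k"
    let ?T = "\<lambda>x::nat\<Rightarrow>real. x(i := c * x i + 0)"
    have i: "i \<in> I" using insert by auto
    have T: "?T \<in> measurable (lborel_on I) (lborel_on I)"
      using i by (intro measurable_fun_upd_lborel_on) auto
    have S: "?S (insert i J) x = ?T (?S J x)" for x
      using insert by auto
    have "(\<integral>\<^sup>+x. g x \<partial>lborel_on I) = ennreal c * (\<integral>\<^sup>+x. g (?T x) \<partial>lborel_on I)"
      using nn_integral_coordinate_affine[OF assms(1) i, of c "\<lambda>_. 0" g] insert.prems assms(3)
      by simp
    also have "(\<integral>\<^sup>+x. g (?T x) \<partial>lborel_on I) = ennreal (c ^ card J) * (\<integral>\<^sup>+x. g (?S (insert i J) x) \<partial>lborel_on I)"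
      unfolding S using insert.prems by (intro insert.IH measurable_compose[OF T]) auto
    finally show ?case
      using insert.hyps assms(3) by (simp only: card_insert_disjoint power_Suc) (simp add: ennreal_mult mult.assoc)
  qed
qed

text \<open>
  The Householder reflection exchanging \<open>v\<close> and the first basis vector is a column shear, followed by
  a map changing only the first coordinate, followed by the inverse column shear. Each factor
  preserves Lebesgue measure by Fubini's theorem and the affine substitution rule on the real line.
\<close>

lemma nn_integral_rotate:
  assumes d: "0 < d" and v: "(\<Sum>i<d. (v i)\<^sup>2) = 1"
    and g [measurable]: "g \<in> borel_measurable (borel \<Otimes>\<^sub>M borel)"
  shows "(\<integral>\<^sup>+x. g (\<Sum>i<d. v i * x i, \<Sum>i<d. (x i)\<^sup>2) \<partial>lborel_on {..<d})
    = (\<integral>\<^sup>+x. g (x 0, \<Sum>i<d. (x i)\<^sup>2) \<partial>lborel_on {..<d})"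
proof -
  define I where "I = {1..<d}"
  have split: "(\<Sum>i<d. f i) = f 0 + (\<Sum>i\<in>I. f i)" for f :: "nat \<Rightarrow> real"
    using d by (simp add: I_def lessThan_atLeast0 sum.atLeast_Suc_lessThan)
  have I: "finite I" "0 \<notin> I" "I \<subseteq> {..<d} - {0}" by (auto simp: I_def)
  show ?thesis
  proof (cases "v 0 = 1")
    \<comment> \<open>Here \<open>v\<close> is already the first basis vector.\<close>
    case True
    then have "(\<Sum>i\<in>I. (v i)\<^sup>2) = 0" using v split[of "\<lambda>i. (v i)\<^sup>2"] by simp
    then have "v i = 0" if "i \<in> I" for i using that I by (simp add: sum_nonneg_eq_0_iff)
    then have "(\<Sum>i<d. v i * x i) = x 0" for x using True by (simp add: split)
    then show ?thesis by simp
  next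
    case False
    \<comment> \<open>These are the entries of the reflection direction relative to its entry at 0.
      Shearing with \<open>-b\<close> projects along that direction onto the coordinates in
      \<open>I\<close>, which the reflection does not change in this frame.\<close>
    define b where "b i = v i / (v 0 - 1)" for i
    define R where "R x = x(0 := -1 * x 0 + (\<Sum>i\<in>I. v i * x i))" for x :: "nat \<Rightarrow> real"
    let ?C = "column_shear I b" and ?C' = "column_shear I (\<lambda>i. - b i)"
    let ?G = "\<lambda>x. g (x 0, \<Sum>i<d. (x i)\<^sup>2)"
    let ?L = "lborel_on {..<d}"
    have coord: "(\<lambda>x. x i) \<in> borel_measurable ?L" if "i < d" for i
      using that by simp
    have sum_I: "(\<lambda>x. \<Sum>i\<in>I. v i * x i) \<in> borel_measurable ?L"
      by (intro borel_measurable_sum borel_measurable_times borel_measurable_const coord) (auto simp: I_def)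
    have sum_I_upd: "(\<Sum>i\<in>I. v i * (x(0 := t)) i) = (\<Sum>i\<in>I. v i * x i)" for x t
      using I(2) by (intro sum.cong) auto
    have R: "R \<in> measurable ?L ?L"
      unfolding R_def using d
      by (intro measurable_fun_upd_lborel_on borel_measurable_add borel_measurable_times
          borel_measurable_const coord sum_I) auto
    have C: "?C \<in> measurable ?L ?L"
      unfolding column_shear_def using d
      by (intro measurable_PiM_single') (auto simp: space_PiM PiE_iff extensional_def I_def)
    have "(\<lambda>x. (x 0, \<Sum>i<d. (x i)\<^sup>2)) \<in> measurable ?L (borel \<Otimes>\<^sub>M borel)"
      using d by (intro measurable_Pair borel_measurable_sum borel_measurable_power coord) auto
    then have G: "?G \<in> borel_measurable ?L" using measurable_compose[OF _ g] by blast
    \<comment> \<open>The composite is the reflection: it sends the first coordinate to the inner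
      product \<open>p\<close> with \<open>v\<close> and keeps the sum of squares.\<close>
    have invariant: "?G (?C (R (?C' x))) = g (\<Sum>i<d. v i * x i, \<Sum>i<d. (x i)\<^sup>2)" for x
    proof -
      define p where "p = (\<Sum>i<d. v i * x i)"
      have sv: "(\<Sum>i\<in>I. (v i)\<^sup>2) = 1 - (v 0)\<^sup>2" using v split[of "\<lambda>i. (v i)\<^sup>2"] by simp
      have svx: "(\<Sum>i\<in>I. v i * x i) = p - v 0 * x 0" using split[of "\<lambda>i. v i * x i"] by (simp add: p_def)
      have "(\<Sum>i\<in>I. v i * (x i - b i * x 0)) = (\<Sum>i\<in>I. v i * x i) - x 0 / (v 0 - 1) * (\<Sum>i\<in>I. (v i)\<^sup>2)"
        unfolding sum_distrib_left sum_subtractf[symmetric]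
        by (intro sum.cong) (auto simp: b_def power2_eq_square algebra_simps)
      also have "\<dots> = p + x 0"
        unfolding sv svx using False by (simp add: field_simps power2_eq_square)
      finally have y0: "(\<Sum>i\<in>I. v i * (x i - b i * x 0)) = p + x 0" .
      have RC': "R (?C' x) = (\<lambda>k. if k = 0 then p else if k \<in> I then x k - b k * x 0 else x k)"
        using I(2) y0 by (auto simp: R_def column_shear_def fun_eq_iff)
      have y: "?C (R (?C' x)) = (\<lambda>k. if k = 0 then p else if k \<in> I then x k + b k * (p - x 0) else x k)"
        unfolding RC' using I by (auto simp: column_shear_def fun_eq_iff algebra_simps)
      have "(\<Sum>i\<in>I. (x i + b i * (p - x 0))\<^sup>2) = (\<Sum>i\<in>I. (x i)\<^sup>2)
          + 2 * (p - x 0) / (v 0 - 1) * (\<Sum>i\<in>I. v i * x i) + ((p - x 0) / (v 0 - 1))\<^sup>2 * (\<Sum>i\<in>I. (v i)\<^sup>2)"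
        unfolding sum_distrib_left sum.distrib[symmetric]
        by (intro sum.cong) (auto simp: b_def power2_eq_square algebra_simps)
      also have "\<dots> = (\<Sum>i\<in>I. (x i)\<^sup>2) + (x 0)\<^sup>2 - p\<^sup>2"
      proof -
        define e where "e = v 0 - 1"
        have e: "e \<noteq> 0" "v 0 = e + 1" using False by (auto simp: e_def)
        show ?thesis unfolding sv svx e(2) using e(1) by (simp add: field_simps power2_eq_square)
      qed
      finally have "p\<^sup>2 + (\<Sum>i\<in>I. (x i + b i * (p - x 0))\<^sup>2) = (\<Sum>i<d. (x i)\<^sup>2)"
        by (simp add: split)
      moreover have "(\<Sum>i\<in>I. (?C (R (?C' x)) i)\<^sup>2) = (\<Sum>i\<in>I. (x i + b i * (p - x 0))\<^sup>2)"
        unfolding y using I by (intro sum.cong) auto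
      ultimately have "(\<Sum>i<d. (?C (R (?C' x)) i)\<^sup>2) = (\<Sum>i<d. (x i)\<^sup>2)"
        by (simp add: split y)
      then show ?thesis by (simp add: y p_def)
    qed
    have "(\<integral>\<^sup>+x. g (\<Sum>i<d. v i * x i, \<Sum>i<d. (x i)\<^sup>2) \<partial>?L) = (\<integral>\<^sup>+x. ?G (?C (R (?C' x))) \<partial>?L)"
      by (simp only: invariant)
    \<comment> \<open>The factors are now removed from the inside out; \<open>R\<close> has
      coefficient -1, whose absolute value is 1.\<close>
    also have "\<dots> = (\<integral>\<^sup>+x. ?G (?C (R x)) \<partial>?L)"
      using d by (intro nn_integral_column_shear measurable_compose[OF R measurable_compose[OF C G]] I) auto
    also have "\<dots> = (\<integral>\<^sup>+x. ?G (?C x) \<partial>?L)"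
      using nn_integral_coordinate_affine[of "{..<d}" 0 "-1", OF _ _ _ sum_I sum_I_upd
          measurable_compose[OF C G]] d
      by (simp add: R_def)
    also have "\<dots> = (\<integral>\<^sup>+x. ?G x \<partial>?L)"
      using d by (intro nn_integral_column_shear G I) auto
    finally show ?thesis .
  qed
qed

text \<open>Substituting \<open>t = r s\<close> for the first coordinate costs a factor
  \<open>r\<close>. After exchanging the integrals, scaling \<open>y\<close> by
  \<open>c = 1 / sqrt (1 + s^2)\<close> turns the ball condition into \<open>r \<le> 1\<close> and
  yields \<open>c^(d-1)\<close> from the volume and one more \<open>c\<close> from the factor
  \<open>r\<close>. The constant \<open>G\<close> is the same for every \<phi>, which makes cone and
  ball comparable.\<close>

lemma nn_integral_cone_coordinates:
  assumes d: "2 \<le> d" and \<phi> [measurable]: "\<phi> \<in> borel_measurable borel"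
  defines "r \<equiv> \<lambda>y::nat \<Rightarrow> real. sqrt (\<Sum>i\<in>{1..<d}. (y i)\<^sup>2)"
  defines "G \<equiv> \<integral>\<^sup>+y. ennreal (r y) * indicator {..1} (r y) \<partial>lborel_on {1..<d}"
  shows "(\<integral>\<^sup>+x. \<phi> (x 0 / r x) * indicator {..1} ((x 0)\<^sup>2 + (r x)\<^sup>2) \<partial>lborel_on {..<d})
    = G * (\<integral>\<^sup>+s. \<phi> s * ennreal ((1 / sqrt (1 + s\<^sup>2)) ^ d) \<partial>lborel)"
proof -
  let ?I = "{1..<d}"
  let ?L = "lborel_on ?I"
  have I: "finite ?I" "0 \<notin> ?I" "{..<d} = insert 0 ?I" "1 \<in> ?I" "card ?I = d - 1" using d by auto
  have r [measurable]: "r \<in> borel_measurable (lborel_on J)" if "?I \<subseteq> J" for J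
    unfolding r_def using that
    by (intro measurable_compose[OF _ borel_measurable_sqrt] borel_measurable_sum borel_measurable_power
        measurable_coordinate) auto
  have r0: "0 \<le> r y" for y by (simp add: r_def sum_nonneg)
  have rL: "r \<in> borel_measurable ?L" by (rule r) simp
  have r_upd: "r (y(0 := t)) = r y" for y t
    unfolding r_def by (intro arg_cong[where f = sqrt] sum.cong) auto
  have F: "(\<lambda>x. \<phi> (x 0 / r x) * indicator {..1} ((x 0)\<^sup>2 + (r x)\<^sup>2)) \<in> borel_measurable (lborel_on {..<d})"
  proof -
    have "(indicator {..1} :: real \<Rightarrow> ennreal) \<in> borel_measurable borel" by simp
    moreover have "r \<in> borel_measurable (lborel_on {..<d})" by (rule r) auto
    moreover have "(\<lambda>x. x 0) \<in> borel_measurable (lborel_on {..<d})"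
      using d by (intro measurable_coordinate) auto
    ultimately show ?thesis
      using \<phi> by measurable
  qed
  have split_0: "(\<integral>\<^sup>+x. f x \<partial>lborel_on {..<d}) = (\<integral>\<^sup>+y. \<integral>\<^sup>+t. f (y(0 := t)) \<partial>lborel \<partial>?L)"
    if "f \<in> borel_measurable (lborel_on {..<d})" for f
    using lborel_on.product_nn_integral_insert[OF I(1,2), of f] that unfolding I(3) by simp
  \<comment> \<open>Zeros of \<open>r\<close> lie in the null set where coordinate 1 vanishes; this
    coordinate exists because \<open>2 \<le> d\<close>.\<close>
  have pos: "AE y in ?L. 0 < r y"
  proof -
    have "AE y in ?L. y 1 \<noteq> 0"
    proof (rule AE_I)
      let ?N = "PiE ?I (\<lambda>i. if i = 1 then {0} else UNIV :: real set)"
      show "{x \<in> space ?L. \<not> x 1 \<noteq> 0} \<subseteq> ?N" by (auto simp: space_PiM PiE_iff extensional_def)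
      show "?N \<in> sets ?L" by (intro sets_PiM_I_finite) auto
      have "emeasure ?L ?N = (\<Prod>i\<in>?I. emeasure lborel (if i = 1 then {0} else UNIV :: real set))"
        by (intro lborel_on.emeasure_PiM) auto
      also have "\<dots> = 0" using I(4) by (intro prod_zero) (auto intro!: bexI[of _ 1])
      finally show "emeasure ?L ?N = 0" .
    qed
    then show ?thesis
    proof eventually_elim
      case (elim y)
      then have "0 < (y 1)\<^sup>2" by simp
      also have "\<dots> \<le> (\<Sum>i\<in>?I. (y i)\<^sup>2)" using I(4) by (intro member_le_sum) auto
      finally show ?case by (simp add: r_def)
    qed
  qed
  have "(\<integral>\<^sup>+x. \<phi> (x 0 / r x) * indicator {..1} ((x 0)\<^sup>2 + (r x)\<^sup>2) \<partial>lborel_on {..<d})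
      = (\<integral>\<^sup>+y. \<integral>\<^sup>+t. \<phi> (t / r y) * indicator {..1} (t\<^sup>2 + (r y)\<^sup>2) \<partial>lborel \<partial>?L)"
    unfolding split_0[OF F] by (simp only: r_upd fun_upd_same)
  also have "\<dots> = (\<integral>\<^sup>+y. \<integral>\<^sup>+s. \<phi> s * (ennreal (r y) * indicator {..1} (sqrt (1 + s\<^sup>2) * r y)) \<partial>lborel \<partial>?L)"
    using pos
  proof (intro nn_integral_cong_AE, eventually_elim)
    case (elim y)
    have "(\<integral>\<^sup>+t. \<phi> (t / r y) * indicator {..1} (t\<^sup>2 + (r y)\<^sup>2) \<partial>lborel)
        = ennreal \<bar>r y\<bar> * (\<integral>\<^sup>+s. \<phi> ((0 + r y * s) / r y) * indicator {..1} ((0 + r y * s)\<^sup>2 + (r y)\<^sup>2) \<partial>lborel)"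
      using elim by (intro nn_integral_real_affine) auto
    also have "\<dots> = (\<integral>\<^sup>+s. ennreal (r y) * (\<phi> ((0 + r y * s) / r y) * indicator {..1} ((0 + r y * s)\<^sup>2 + (r y)\<^sup>2)) \<partial>lborel)"
      using elim by (subst nn_integral_cmult) auto
    also have "\<dots> = (\<integral>\<^sup>+s. \<phi> s * (ennreal (r y) * indicator {..1} (sqrt (1 + s\<^sup>2) * r y)) \<partial>lborel)"
    proof (intro nn_integral_cong)
      fix s :: real
      \<comment> \<open>The ball condition becomes a bound on a multiple of \<open>r y\<close>, the
        form that the later scaling of \<open>y\<close> simplifies.\<close>
      have "(0 + r y * s)\<^sup>2 + (r y)\<^sup>2 = (sqrt (1 + s\<^sup>2) * r y)\<^sup>2"
        by (simp add: power_mult_distrib algebra_simps)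
      moreover have "0 \<le> sqrt (1 + s\<^sup>2) * r y" using r0 by simp
      ultimately have "(0 + r y * s)\<^sup>2 + (r y)\<^sup>2 \<le> 1 \<longleftrightarrow> sqrt (1 + s\<^sup>2) * r y \<le> 1"
        by (metis abs_of_nonneg abs_square_le_1)
      then show "ennreal (r y) * (\<phi> ((0 + r y * s) / r y) * indicator {..1} ((0 + r y * s)\<^sup>2 + (r y)\<^sup>2))
          = \<phi> s * (ennreal (r y) * indicator {..1} (sqrt (1 + s\<^sup>2) * r y))"
        using elim by (simp add: indicator_def mult_ac)
    qed
    finally show ?case .
  qed
  also have "\<dots> = (\<integral>\<^sup>+s. \<integral>\<^sup>+y. \<phi> s * (ennreal (r y) * indicator {..1} (sqrt (1 + s\<^sup>2) * r y)) \<partial>?L \<partial>lborel)"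
  proof -
    interpret L: sigma_finite_measure ?L by (rule lborel_on.sigma_finite) simp
    interpret P: pair_sigma_finite ?L "lborel :: real measure" ..
    show ?thesis
      by (rule P.Fubini'[symmetric]) (use rL in measurable)
  qed
  also have "\<dots> = (\<integral>\<^sup>+s. \<phi> s * (ennreal ((1 / sqrt (1 + s\<^sup>2)) ^ d) * G) \<partial>lborel)"
  proof (intro nn_integral_cong)
    fix s :: real
    define c where "c = 1 / sqrt (1 + s\<^sup>2)"
    have q: "0 < sqrt (1 + s\<^sup>2)" by (simp add: add_pos_nonneg)
    have c: "0 < c" using q by (simp add: c_def)
    have r_scale: "r (\<lambda>k. if k \<in> ?I then c * y k else y k) = c * r y" for y
    proof -
      have "(\<Sum>i\<in>?I. (if i \<in> ?I then c * y i else y i)\<^sup>2) = c\<^sup>2 * (\<Sum>i\<in>?I. (y i)\<^sup>2)"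
        unfolding sum_distrib_left by (intro sum.cong) (auto simp: power_mult_distrib)
      then show ?thesis using c by (simp only: r_def) (simp add: real_sqrt_mult)
    qed
    have "(\<integral>\<^sup>+y. \<phi> s * (ennreal (r y) * indicator {..1} (sqrt (1 + s\<^sup>2) * r y)) \<partial>?L)
        = \<phi> s * (\<integral>\<^sup>+y. (ennreal (r y) * indicator {..1} (sqrt (1 + s\<^sup>2) * r y)) \<partial>?L)"
      by (rule nn_integral_cmult) (use rL in measurable)
    also have "(\<integral>\<^sup>+y. (ennreal (r y) * indicator {..1} (sqrt (1 + s\<^sup>2) * r y)) \<partial>?L)
        = ennreal (c ^ (d - 1)) * (\<integral>\<^sup>+y. (ennreal (c * r y) * indicator {..1} (sqrt (1 + s\<^sup>2) * (c * r y))) \<partial>?L)"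
      unfolding I(5)[symmetric] r_scale[symmetric] using c I(1)
      by (intro nn_integral_scale) (use rL in measurable)
    also have "(\<integral>\<^sup>+y. (ennreal (c * r y) * indicator {..1} (sqrt (1 + s\<^sup>2) * (c * r y))) \<partial>?L)
        = (\<integral>\<^sup>+y. ennreal c * (ennreal (r y) * indicator {..1} (r y)) \<partial>?L)"
    proof -
      have e: "sqrt (1 + s\<^sup>2) * (c * t) = t" for t using q by (simp add: c_def)
      show ?thesis unfolding e using c r0 by (intro nn_integral_cong) (simp add: ennreal_mult mult.assoc)
    qed
    also have "\<dots> = ennreal c * G"
      unfolding G_def by (rule nn_integral_cmult) (use rL in measurable)
    also have "ennreal (c ^ (d - 1)) * (ennreal c * G) = ennreal (c ^ d) * G"
      using c d by (simp add: ennreal_mult[symmetric] mult.assoc[symmetric] power_Suc2[symmetric] del: power_Suc)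
    finally show "(\<integral>\<^sup>+y. \<phi> s * (ennreal (r y) * indicator {..1} (sqrt (1 + s\<^sup>2) * r y)) \<partial>?L)
        = \<phi> s * (ennreal ((1 / sqrt (1 + s\<^sup>2)) ^ d) * G)"
      unfolding c_def .
  qed
  also have "\<dots> = (\<integral>\<^sup>+s. G * (\<phi> s * ennreal ((1 / sqrt (1 + s\<^sup>2)) ^ d)) \<partial>lborel)"
    by (simp add: mult_ac)
  also have "\<dots> = G * (\<integral>\<^sup>+s. \<phi> s * ennreal ((1 / sqrt (1 + s\<^sup>2)) ^ d) \<partial>lborel)"
    by (rule nn_integral_cmult) simp
  finally show ?thesis .
qed

text \<open>From \<open>1 + s^2 \<le> exp (s^2)\<close> the weight dominates
  \<open>exp (- d s^2 / 2)\<close>, which is \<open>sqrt (2 pi / d)\<close> times the normal density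
  of variance \<open>1 / d\<close>.\<close>

lemma nn_integral_cone_weight_ge:
  assumes "0 < d"
  shows "ennreal (sqrt (2 * pi / real d)) \<le> (\<integral>\<^sup>+s. ennreal ((1 / sqrt (1 + s\<^sup>2)) ^ d) \<partial>lborel)"
proof -
  define \<sigma> where "\<sigma> = 1 / sqrt (real d)"
  have \<sigma>: "0 < \<sigma>" "\<sigma>\<^sup>2 = 1 / real d" using assms by (auto simp: \<sigma>_def power_divide)
  have "(\<integral>\<^sup>+s. ennreal (normal_density 0 \<sigma> s) \<partial>lborel) = 1"
    using nn_integral_eq_integral[OF integrable_normal_density[OF \<sigma>(1), of 0]] integral_normal_density[OF \<sigma>(1), of 0]
      normal_density_nonneg by simp
  then have "ennreal (sqrt (2 * pi / real d)) = (\<integral>\<^sup>+s. ennreal (sqrt (2 * pi / real d)) * ennreal (normal_density 0 \<sigma> s) \<partial>lborel)"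
    by (subst nn_integral_cmult) auto
  also have "\<dots> \<le> (\<integral>\<^sup>+s. ennreal ((1 / sqrt (1 + s\<^sup>2)) ^ d) \<partial>lborel)"
  proof (intro nn_integral_mono)
    fix s :: real
    have q: "0 < 1 + s\<^sup>2" by (simp add: add_pos_nonneg)
    have "sqrt (2 * pi / real d) * normal_density 0 \<sigma> s = exp (- (s\<^sup>2 * real d / 2))"
      using assms by (simp add: normal_density_def \<sigma>(2))
    also have "\<dots> = (exp (- (s\<^sup>2 / 2))) ^ d"
      by (simp add: exp_of_nat_mult[symmetric] mult_ac)
    also have "\<dots> \<le> (1 / sqrt (1 + s\<^sup>2)) ^ d"
    proof (rule power_mono)
      have "sqrt (1 + s\<^sup>2) \<le> sqrt (exp (s\<^sup>2))" using exp_ge_add_one_self[of "s\<^sup>2"] by simp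
      also have "sqrt (exp (s\<^sup>2)) = exp (s\<^sup>2 / 2)"
        by (rule real_sqrt_unique) (simp_all add: power2_eq_square exp_add[symmetric])
      finally show "exp (- (s\<^sup>2 / 2)) \<le> 1 / sqrt (1 + s\<^sup>2)"
        using q by (simp add: exp_minus inverse_eq_divide frac_le)
    qed simp
    finally show "ennreal (sqrt (2 * pi / real d)) * ennreal (normal_density 0 \<sigma> s) \<le> ennreal ((1 / sqrt (1 + s\<^sup>2)) ^ d)"
      by (simp add: ennreal_mult[symmetric] normal_density_nonneg ennreal_leI)
  qed
  finally show ?thesis .
qed

text \<open>After rotation and in cone coordinates the cone becomes an interval of length
  \<open>2 / sqrt K\<close> in \<open>s\<close>, on which the weight is at most 1, while the ball
  gives the full integral of the weight. The multiplied-out form avoids dividing by the volume of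
  the ball.\<close>

lemma cone_measure_le:
  assumes d: "2 \<le> d" and v: "(\<Sum>i<d. (v i)\<^sup>2) = 1" and K: "0 < K"
  defines "L \<equiv> lborel_on {..<d}"
  shows "ennreal (sqrt (2 * pi / real d)) *
      emeasure L {x \<in> space L. K * (\<Sum>i<d. v i * x i)\<^sup>2 \<le> (\<Sum>i<d. (x i)\<^sup>2) - (\<Sum>i<d. v i * x i)\<^sup>2 \<and> (\<Sum>i<d. (x i)\<^sup>2) \<le> 1}
    \<le> ennreal (2 / sqrt K) * emeasure L {x \<in> space L. (\<Sum>i<d. (x i)\<^sup>2) \<le> 1}"
proof -
  define r where "r y = sqrt (\<Sum>i\<in>{1..<d}. (y i)\<^sup>2)" for y :: "nat \<Rightarrow> real"
  define G where "G = (\<integral>\<^sup>+y. ennreal (r y) * indicator {..1} (r y) \<partial>lborel_on {1..<d})"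
  note polar = nn_integral_cone_coordinates[OF d, folded r_def, folded G_def L_def]
  let ?w = "\<lambda>s::real. ennreal ((1 / sqrt (1 + s\<^sup>2)) ^ d)"
  have split: "(\<Sum>i<d. (x i)\<^sup>2) = (x 0)\<^sup>2 + (r x)\<^sup>2" for x :: "nat \<Rightarrow> real"
    using d by (simp add: r_def sum_nonneg lessThan_atLeast0 sum.atLeast_Suc_lessThan)
  have coord: "(\<lambda>x. x i) \<in> borel_measurable L" if "i < d" for i
    using that by (simp add: L_def)
  have sq: "(\<lambda>x. \<Sum>i<d. (x i)\<^sup>2) \<in> borel_measurable L"
    by (intro borel_measurable_sum borel_measurable_power coord) auto
  have vx: "(\<lambda>x. \<Sum>i<d. v i * x i) \<in> borel_measurable L"
    by (intro borel_measurable_sum borel_measurable_times borel_measurable_const coord) auto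
  let ?B = "{x \<in> space L. K * (\<Sum>i<d. v i * x i)\<^sup>2 \<le> (\<Sum>i<d. (x i)\<^sup>2) - (\<Sum>i<d. v i * x i)\<^sup>2 \<and> (\<Sum>i<d. (x i)\<^sup>2) \<le> 1}"
  \<comment> \<open>The cone depends only on the inner product \<open>t\<close> with
    \<open>v\<close> and the squared norm \<open>q\<close>, as the rotation lemma requires.\<close>
  let ?g = "\<lambda>(t, q). indicator {(t, q). K * t\<^sup>2 \<le> q - t\<^sup>2 \<and> q \<le> 1} (t, q) :: ennreal"
  have "?B \<in> sets L"
    by (intro sets.sets_Collect_conj borel_measurable_le borel_measurable_times borel_measurable_diff
        borel_measurable_power borel_measurable_const vx sq)
  then have "emeasure L ?B = (\<integral>\<^sup>+x. indicator ?B x \<partial>L)" by simp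
  also have "\<dots> = (\<integral>\<^sup>+x. ?g (\<Sum>i<d. v i * x i, \<Sum>i<d. (x i)\<^sup>2) \<partial>L)"
    by (intro nn_integral_cong) (simp add: indicator_def)
  also have "\<dots> = (\<integral>\<^sup>+x. ?g (x 0, \<Sum>i<d. (x i)\<^sup>2) \<partial>L)"
    unfolding L_def using d by (intro nn_integral_rotate v) auto
  also have "\<dots> \<le> (\<integral>\<^sup>+x. indicator {- (1 / sqrt K)..1 / sqrt K} (x 0 / r x) * indicator {..1} ((x 0)\<^sup>2 + (r x)\<^sup>2) \<partial>L)"
  proof (intro nn_integral_mono)
    fix x :: "nat \<Rightarrow> real"
    have bound: "\<bar>x 0 / r x\<bar> \<le> 1 / sqrt K" if "K * (x 0)\<^sup>2 \<le> (r x)\<^sup>2"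
    \<comment> \<open>For \<open>r x = 0\<close> the quotient is 0 by convention and the bound is
      trivial.\<close>
    proof (cases "r x = 0")
      case False
      then have "0 < r x" by (simp add: r_def sum_nonneg order_less_le)
      moreover have "sqrt K * \<bar>x 0\<bar> \<le> r x"
        using real_sqrt_le_mono[OF that] \<open>0 < r x\<close> by (simp add: real_sqrt_mult)
      ultimately show ?thesis using K by (simp add: field_simps)
    qed (use K in simp)
    have "x 0 / r x \<in> {- (1 / sqrt K)..1 / sqrt K}" if "K * (x 0)\<^sup>2 \<le> (r x)\<^sup>2"
      using bound[OF that] unfolding abs_le_iff atLeastAtMost_iff by linarith
    then show "?g (x 0, \<Sum>i<d. (x i)\<^sup>2)
        \<le> indicator {- (1 / sqrt K)..1 / sqrt K} (x 0 / r x) * indicator {..1} ((x 0)\<^sup>2 + (r x)\<^sup>2)"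
      unfolding split by (simp add: indicator_def)
  qed
  also have "\<dots> = G * (\<integral>\<^sup>+s. indicator {- (1 / sqrt K)..1 / sqrt K} s * ?w s \<partial>lborel)"
    by (rule polar) simp
  also have "\<dots> \<le> G * ennreal (2 / sqrt K)"
  proof (intro mult_left_mono)
    have "(\<integral>\<^sup>+s. indicator {- (1 / sqrt K)..1 / sqrt K} s * ?w s \<partial>lborel)
        \<le> (\<integral>\<^sup>+s. indicator {- (1 / sqrt K)..1 / sqrt K} s \<partial>lborel)"
    proof (intro nn_integral_mono)
      fix s :: real
      have "(1 / sqrt (1 + s\<^sup>2)) ^ d \<le> 1"
        by (intro power_le_one) (simp_all add: divide_le_eq_1 add_pos_nonneg)
      then show "indicator {- (1 / sqrt K)..1 / sqrt K} s * ?w s \<le> indicator {- (1 / sqrt K)..1 / sqrt K} s"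
        by (auto simp: indicator_def ennreal_le_1)
    qed
    also have "\<dots> = ennreal (2 / sqrt K)" using K by simp
    finally show "(\<integral>\<^sup>+s. indicator {- (1 / sqrt K)..1 / sqrt K} s * ?w s \<partial>lborel) \<le> ennreal (2 / sqrt K)" .
  qed simp
  finally have bad: "emeasure L ?B \<le> G * ennreal (2 / sqrt K)" .
  have "{x \<in> space L. (\<Sum>i<d. (x i)\<^sup>2) \<le> 1} \<in> sets L"
    by (intro borel_measurable_le borel_measurable_const sq)
  then have "emeasure L {x \<in> space L. (\<Sum>i<d. (x i)\<^sup>2) \<le> 1} = (\<integral>\<^sup>+x. indicator {x \<in> space L. (\<Sum>i<d. (x i)\<^sup>2) \<le> 1} x \<partial>L)"
    by simp
  also have "\<dots> = (\<integral>\<^sup>+x. 1 * indicator {..1} ((x 0)\<^sup>2 + (r x)\<^sup>2) \<partial>L)"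
    by (intro nn_integral_cong) (simp add: indicator_def split)
  also have "\<dots> = G * (\<integral>\<^sup>+s. 1 * ?w s \<partial>lborel)"
    by (rule polar) simp
  finally have ball: "emeasure L {x \<in> space L. (\<Sum>i<d. (x i)\<^sup>2) \<le> 1} = G * (\<integral>\<^sup>+s. ?w s \<partial>lborel)" by simp
  have "ennreal (sqrt (2 * pi / real d)) * emeasure L ?B \<le> (\<integral>\<^sup>+s. ?w s \<partial>lborel) * (G * ennreal (2 / sqrt K))"
    using bad nn_integral_cone_weight_ge[of d] d by (intro mult_mono) auto
  then show ?thesis unfolding ball by (simp add: mult_ac)
qed

section \<open>The uniform distribution on the sphere\<close>

lemma scalar_prod_eq_sum: "v \<in> carrier_vec d \<Longrightarrow> x \<bullet> v = (\<Sum>i<d. x $ i * v $ i)"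
  by (simp add: scalar_prod_def atLeast0LessThan)

lemma unit_sphere_iff: "x \<in> unit_sphere d \<longleftrightarrow> x \<in> carrier_vec d \<and> x \<bullet> x = 1"
  by (simp add: unit_sphere_def vnorm_def)

text \<open>Pythagoras puts the inner product into the domain of \<open>arccos\<close>. The tangent
  formula also covers orthogonal vectors, where both sides are 0 by the convention for division by
  zero.\<close>

lemma line_angle_unit:
  assumes x: "x \<in> unit_sphere d" and v: "v \<in> unit_sphere d"
  shows "cos (line_angle x v) = \<bar>x \<bullet> v\<bar>"
    and "(tan (line_angle x v))\<^sup>2 = (1 - (x \<bullet> v)\<^sup>2) / (x \<bullet> v)\<^sup>2"
proof -
  note x = x[unfolded unit_sphere_iff] and v = v[unfolded unit_sphere_iff]
  obtain w where w: "w \<in> carrier_vec d" "w \<bullet> v = 0" "x = (x \<bullet> v) \<cdot>\<^sub>v v + w"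
    using orthogonal_decomposition[of v d x] x v by metis
  have "1 = (x \<bullet> v)\<^sup>2 + w \<bullet> w"
    using scalar_prod_orthogonal_sum[of v d w w "x \<bullet> v" "x \<bullet> v"] w x v by (simp add: power2_eq_square)
  then have "(x \<bullet> v)\<^sup>2 \<le> 1" using scalar_prod_self_nonneg[of w] by linarith
  then have le: "\<bar>x \<bullet> v\<bar> \<le> 1" by (simp add: abs_square_le_1)
  then show "cos (line_angle x v) = \<bar>x \<bullet> v\<bar>" by (simp add: line_angle_def)
  show "(tan (line_angle x v))\<^sup>2 = (1 - (x \<bullet> v)\<^sup>2) / (x \<bullet> v)\<^sup>2"
    using le \<open>(x \<bullet> v)\<^sup>2 \<le> 1\<close> by (simp add: line_angle_def tan_def sin_arccos_abs power_divide)
qed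

lemma measurable_scalar_prod:
  assumes "f \<in> measurable M (borel_vec d)" "g \<in> measurable M (borel_vec d)"
  shows "(\<lambda>x. f x \<bullet> g x) \<in> borel_measurable M"
proof -
  have "(\<lambda>x. \<Sum>i<d. f x $ i * g x $ i) \<in> borel_measurable M"
    by (intro borel_measurable_sum borel_measurable_times
        measurable_compose[OF assms(1) measurable_borel_vec_index]
        measurable_compose[OF assms(2) measurable_borel_vec_index]) auto
  then show ?thesis
    by (rule measurable_cong[THEN iffD1, rotated])
      (use measurable_space[OF assms(2)] in \<open>simp add: scalar_prod_eq_sum[of _ d]\<close>)
qed

lemma measurable_mult_mat_vec:
  assumes "B \<in> carrier_mat d d"
  shows "(\<lambda>x. B *\<^sub>v x) \<in> measurable (borel_vec d) (borel_vec d)"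
proof (rule measurable_into_borel_vec)
  fix i assume i: "i < d"
  have "(\<lambda>x. Matrix.row B i \<bullet> x) \<in> borel_measurable (borel_vec d)"
    by (intro measurable_scalar_prod[where d = d] measurable_ident measurable_const) (use assms i in auto)
  then show "(\<lambda>x. (B *\<^sub>v x) $ i) \<in> borel_measurable (borel_vec d)"
    using assms i by simp
qed (use assms in auto)

lemma measurable_rayleigh_pow:
  assumes "B \<in> carrier_mat d d"
  shows "(\<lambda>x. rayleigh_pow B x q) \<in> borel_measurable (borel_vec d)"
proof -
  have p: "(\<lambda>x. power_iterate B x q) \<in> measurable (borel_vec d) (borel_vec d)"
  proof (induction q)
    case (Suc q)
    then show ?case
      using measurable_compose[OF measurable_compose[OF Suc measurable_mult_mat_vec[OF assms]] measurable_normalize_vec]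
      by simp
  qed simp
  show ?thesis
    unfolding rayleigh_pow_def
    by (intro measurable_scalar_prod[where d = d] p measurable_compose[OF p measurable_mult_mat_vec[OF assms]])
qed

lemma measurable_uniform_sphere:
  "f \<in> measurable (borel_vec d) N \<Longrightarrow> f \<in> measurable (uniform_sphere d) N"
  unfolding uniform_sphere_def by (intro measurable_restrict_space1) simp

lemma sets_uniform_sphere:
  assumes "A \<in> sets (borel_vec d)" "A \<subseteq> unit_sphere d"
  shows "A \<in> sets (uniform_sphere d)"
  unfolding uniform_sphere_def
  using assms sets_unit_sphere[of d] by (auto simp: sets_restrict_space image_iff intro!: bexI[of _ A])

text \<open>Unfolding the cone measure: the mass of \<open>A\<close> is the share of the ball taken
  by the points projecting radially into \<open>A\<close>.\<close>

lemma emeasure_uniform_sphere: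
  assumes A: "A \<in> sets (borel_vec d)" "A \<subseteq> unit_sphere d"
  defines "L \<equiv> lborel_on {..<d}"
  shows "emeasure (uniform_sphere d) A =
    emeasure L {x \<in> space L. (\<Sum>i<d. (x i)\<^sup>2) \<le> 1 \<and> normalize_vec (Matrix.vec d x) \<in> A}
    / emeasure L {x \<in> space L. (\<Sum>i<d. (x i)\<^sup>2) \<le> 1}"
proof -
  let ?U = "uniform_measure (lborel_vec d) (unit_ball d)"
  let ?N = "normalize_vec -` A \<inter> carrier_vec d"
  have S: "sets (lborel_vec d) = sets (borel_vec d)" "space (lborel_vec d) = carrier_vec d"
    by (simp_all add: lborel_vec_def)
  have mn: "normalize_vec \<in> measurable ?U (borel_vec d)"
    using measurable_normalize_vec[of d] S by (simp cong: measurable_cong_sets)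
  have N: "?N \<in> sets (borel_vec d)"
    using measurable_sets[OF measurable_normalize_vec A(1)] by simp
  have vol: "emeasure (lborel_vec d) X = emeasure L (Matrix.vec d -` X \<inter> space L)" if "X \<in> sets (borel_vec d)" for X
    unfolding lborel_vec_def L_def by (rule emeasure_distr[OF measurable_vec that])
  have "emeasure (uniform_sphere d) A = emeasure (distr ?U (borel_vec d) normalize_vec) A"
    unfolding uniform_sphere_def using A(2) sets_unit_sphere[of d] sets.sets_into_space[OF sets_unit_sphere[of d]]
    by (intro emeasure_restrict_space) (auto simp: Int_absorb2)
  also have "\<dots> = emeasure ?U ?N"
    using S by (simp add: emeasure_distr[OF mn A(1)])
  also have "\<dots> = emeasure (lborel_vec d) (unit_ball d \<inter> ?N) / emeasure (lborel_vec d) (unit_ball d)"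
    using N sets_unit_ball[of d] S by (intro emeasure_uniform_measure) auto
  also have "emeasure (lborel_vec d) (unit_ball d \<inter> ?N)
      = emeasure L {x \<in> space L. (\<Sum>i<d. (x i)\<^sup>2) \<le> 1 \<and> normalize_vec (Matrix.vec d x) \<in> A}"
    using N sets_unit_ball[of d]
    by (subst vol) (auto intro!: arg_cong2[where f = emeasure] simp: unit_ball_def vnorm_vec_le)
  also have "emeasure (lborel_vec d) (unit_ball d) = emeasure L {x \<in> space L. (\<Sum>i<d. (x i)\<^sup>2) \<le> 1}"
    by (subst vol[OF sets_unit_ball]) (auto intro!: arg_cong2[where f = emeasure] simp: unit_ball_def vnorm_vec_le)
  finally show ?thesis .
qed

text \<open>The inequality defining \<open>A\<close> becomes homogeneous once 1 is read as the
  squared norm, so points of the ball that project into \<open>A\<close> lie in the cone of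
  \<open>cone_measure_le\<close>.\<close>

lemma uniform_sphere_cap_le:
  assumes d: "2 \<le> d" and v: "v \<in> unit_sphere d" and K: "0 < K"
  defines "A \<equiv> {x \<in> unit_sphere d. K * (x \<bullet> v)\<^sup>2 \<le> 1 - (x \<bullet> v)\<^sup>2}"
  shows "A \<in> sets (uniform_sphere d)"
    and "sqrt (2 * pi / real d) * measure (uniform_sphere d) A \<le> 2 / sqrt K"
proof -
  define L where "L = lborel_on {..<d}"
  interpret prob_space "uniform_sphere d" using d by (intro prob_space_uniform_sphere) auto
  have v': "v \<in> carrier_vec d" "v \<bullet> v = 1" using v by (simp_all add: unit_sphere_iff)
  have xv: "(\<lambda>x. x \<bullet> v) \<in> borel_measurable (borel_vec d)"
    by (intro measurable_scalar_prod measurable_ident measurable_const) (use v' in auto)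
  have "unit_sphere d \<inter> {x \<in> space (borel_vec d). K * (x \<bullet> v)\<^sup>2 \<le> 1 - (x \<bullet> v)\<^sup>2} \<in> sets (borel_vec d)"
    by (intro sets.Int sets_unit_sphere borel_measurable_le borel_measurable_times borel_measurable_diff
        borel_measurable_power borel_measurable_const xv)
  also have "unit_sphere d \<inter> {x \<in> space (borel_vec d). K * (x \<bullet> v)\<^sup>2 \<le> 1 - (x \<bullet> v)\<^sup>2} = A"
    by (auto simp: A_def unit_sphere_iff)
  finally have A: "A \<in> sets (borel_vec d)" "A \<subseteq> unit_sphere d" by (auto simp: A_def)
  then show "A \<in> sets (uniform_sphere d)" by (rule sets_uniform_sphere)
  let ?s = "\<lambda>x. \<Sum>i<d. v $ i * x i"
  let ?C = "{x \<in> space L. K * (?s x)\<^sup>2 \<le> (\<Sum>i<d. (x i)\<^sup>2) - (?s x)\<^sup>2 \<and> (\<Sum>i<d. (x i)\<^sup>2) \<le> 1}"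
  let ?D = "{x \<in> space L. (\<Sum>i<d. (x i)\<^sup>2) \<le> 1}"
  let ?E = "{x \<in> space L. (\<Sum>i<d. (x i)\<^sup>2) \<le> 1 \<and> normalize_vec (Matrix.vec d x) \<in> A}"
  have "?E \<subseteq> ?C"
  proof
    fix x assume x: "x \<in> ?E"
    let ?y = "Matrix.vec d x"
    define q where "q = (\<Sum>i<d. (x i)\<^sup>2)"
    have q: "(vnorm ?y)\<^sup>2 = q" using vnorm_sq[of ?y d] by (simp add: q_def)
    have sy: "?y \<bullet> v = ?s x" using v' by (simp add: scalar_prod_eq_sum mult.commute)
    have n: "normalize_vec ?y \<bullet> v = ?s x / vnorm ?y"
      unfolding normalize_vec_def using v' by (simp add: sy)
    have "K * (?s x / vnorm ?y)\<^sup>2 \<le> 1 - (?s x / vnorm ?y)\<^sup>2" "normalize_vec ?y \<in> unit_sphere d"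
      using x unfolding A_def mem_Collect_eq n by auto
    \<comment> \<open>The origin is normalised to the zero vector, which is not on the
      sphere.\<close>
    moreover from this(2) have "vnorm ?y \<noteq> 0"
      by (auto simp: normalize_vec_def unit_sphere_iff)
    ultimately have "K * (?s x)\<^sup>2 \<le> q - (?s x)\<^sup>2"
      unfolding q[symmetric] by (simp add: power_divide field_simps)
    then show "x \<in> ?C" using x by (simp add: q_def)
  qed
  moreover have "?C \<in> sets L"
  proof -
    have coord: "(\<lambda>x. x i) \<in> borel_measurable L" if "i < d" for i
      using that by (simp add: L_def)
    have "(\<lambda>x. \<Sum>i<d. (x i)\<^sup>2) \<in> borel_measurable L" "?s \<in> borel_measurable L"
      by (intro borel_measurable_sum borel_measurable_power borel_measurable_times borel_measurable_const coord; simp)+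
    then show ?thesis
      by (intro sets.sets_Collect_conj borel_measurable_le borel_measurable_times borel_measurable_diff
          borel_measurable_power borel_measurable_const)
  qed
  ultimately have EC: "emeasure L ?E \<le> emeasure L ?C" by (rule emeasure_mono)
  have "(\<Sum>i<d. (v $ i)\<^sup>2) = 1" using v' by (simp add: scalar_prod_eq_sum power2_eq_square)
  note cone = cone_measure_le[OF d this K, folded L_def]
  let ?a = "ennreal (sqrt (2 * pi / real d))" and ?b = "ennreal (2 / sqrt K)"
  have "?a * emeasure (uniform_sphere d) A = ?a * emeasure L ?E / emeasure L ?D"
    unfolding emeasure_uniform_sphere[OF A, folded L_def] by (rule ennreal_times_divide)
  also have "\<dots> \<le> ?b * emeasure L ?D / emeasure L ?D"
    using order_trans[OF mult_left_mono[OF EC] cone] by (intro divide_right_mono_ennreal) simp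
  also have "\<dots> = ?b * (emeasure L ?D / emeasure L ?D)" by (rule ennreal_times_divide[symmetric])
  also have "\<dots> \<le> ?b * 1"
  proof (intro mult_left_mono)
    \<comment> \<open>At 0 and at infinity the extended quotient is 0, so no case exceeds 1.\<close>
    show "emeasure L ?D / emeasure L ?D \<le> 1"
      by (cases "emeasure L ?D = 0 \<or> emeasure L ?D = \<infinity>")
        (auto simp: less_top[symmetric])
  qed simp
  finally have "ennreal (sqrt (2 * pi / real d) * measure (uniform_sphere d) A) \<le> ennreal (2 / sqrt K)"
    by (simp add: emeasure_eq_measure ennreal_mult)
  then show "sqrt (2 * pi / real d) * measure (uniform_sphere d) A \<le> 2 / sqrt K"
    using K by (simp add: ennreal_le_iff)
qed

text \<open>This is the cap bound at the threshold for the squared tangent. The multiplied-out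
  inequality keeps vectors orthogonal to \<open>v\<close> inside \<open>A\<close>, so the
  exceptional set also contains the case of an infinite tangent.\<close>

lemma uniform_sphere_tan_tail:
  assumes d: "2 \<le> d" and v: "v \<in> unit_sphere d" and \<delta>: "0 < \<delta>"
  defines "A \<equiv> {x \<in> unit_sphere d. (0.824\<^sup>2 * real d / \<delta>\<^sup>2) * (x \<bullet> v)\<^sup>2 \<le> 1 - (x \<bullet> v)\<^sup>2}"
  shows "A \<in> sets (uniform_sphere d)" and "measure (uniform_sphere d) A \<le> \<delta>"
proof -
  have K: "0 < 0.824\<^sup>2 * real d / \<delta>\<^sup>2" using d \<delta> by simp
  note cap = uniform_sphere_cap_le[OF d v K, folded A_def]
  then show "A \<in> sets (uniform_sphere d)" by simp
  \<comment> \<open>The rational bound 2.5 for \<open>sqrt (2 pi)\<close> suffices, as 0.824 times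
    2.5 is 2.06.\<close>
  have "2.5\<^sup>2 \<le> 2 * pi" using pi_approx by (simp add: power2_eq_square)
  then have "2.5 \<le> sqrt (2 * pi)" by (rule real_le_rsqrt)
  then have pi: "2 \<le> 0.824 * sqrt (2 * pi)" by simp
  let ?m = "measure (uniform_sphere d) A"
  have "sqrt (0.824\<^sup>2 * real d / \<delta>\<^sup>2) = 0.824 * sqrt (real d) / \<delta>"
    using \<delta> by (simp add: real_sqrt_mult real_sqrt_divide)
  then have "sqrt (2 * pi) / sqrt (real d) * ?m \<le> 2 * \<delta> / (0.824 * sqrt (real d))"
    using cap(2) \<delta> by (simp add: real_sqrt_divide)
  then have "0.824 * sqrt (2 * pi) * ?m \<le> 2 * \<delta>"
    using d by (simp add: field_simps)
  moreover have "2 * ?m \<le> 0.824 * sqrt (2 * pi) * ?m"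
    by (rule mult_right_mono[OF pi measure_nonneg])
  ultimately show "?m \<le> \<delta>" by linarith
qed

section \<open>Pathwise, probabilistic and almost sure bounds for the power iteration\<close>

context power_method
begin

lemma v_unit: "v \<in> unit_sphere d"
  using v by (simp add: unit_sphere_iff)

lemma pathwise_bound:
  assumes x: "x \<in> unit_sphere d" and cos: "cos (line_angle x v) \<noteq> 0"
  shows "\<mu> - rayleigh_pow B x q \<le> \<mu> * (M / \<mu>) ^ (2 * q) * (tan (line_angle x v))\<^sup>2"
  using rayleigh_pow_bounds(2)[of x q] assms line_angle_unit[OF x v_unit] by (simp add: unit_sphere_iff)

lemma measurable_scalar_prod_v: "(\<lambda>x. x \<bullet> v) \<in> borel_measurable (uniform_sphere d)"
  by (intro measurable_uniform_sphere measurable_scalar_prod[where d = d] measurable_ident measurable_const)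
    (use v in auto)

lemma tan_tail:
  assumes d: "2 \<le> d" and \<delta>: "0 < \<delta>"
  defines "S \<equiv> {x \<in> space (uniform_sphere d). cos (line_angle x v) \<noteq> 0 \<and>
      (tan (line_angle x v))\<^sup>2 \<le> 0.824\<^sup>2 * real d / \<delta>\<^sup>2}"
  shows "S \<in> sets (uniform_sphere d)" "1 - \<delta> \<le> measure (uniform_sphere d) S"
proof -
  interpret prob_space "uniform_sphere d" using d by (intro prob_space_uniform_sphere) auto
  let ?K = "0.824\<^sup>2 * real d / \<delta>\<^sup>2"
  let ?A = "{x \<in> unit_sphere d. ?K * (x \<bullet> v)\<^sup>2 \<le> 1 - (x \<bullet> v)\<^sup>2}"
  have K: "0 < ?K" using d \<delta> by simp
  note A = uniform_sphere_tan_tail[OF d v_unit \<delta>]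
  have S: "S = space (uniform_sphere d) - {x \<in> space (uniform_sphere d). x \<bullet> v = 0 \<or> ?K < (1 - (x \<bullet> v)\<^sup>2) / (x \<bullet> v)\<^sup>2}"
    unfolding S_def using line_angle_unit[OF _ v_unit] by auto
  have null: "{x \<in> space (uniform_sphere d). x \<bullet> v = 0} \<in> sets (uniform_sphere d)"
    by (intro borel_measurable_eq borel_measurable_const measurable_scalar_prod_v)
  have "{x \<in> space (uniform_sphere d). ?K < (1 - (x \<bullet> v)\<^sup>2) / (x \<bullet> v)\<^sup>2} \<in> sets (uniform_sphere d)"
    by (intro borel_measurable_less borel_measurable_const borel_measurable_divide borel_measurable_diff
        borel_measurable_power measurable_scalar_prod_v)
  with null show S_sets: "S \<in> sets (uniform_sphere d)"
    unfolding S by (intro sets.compl_sets sets.sets_Collect_disj)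
  have "space (uniform_sphere d) - ?A \<subseteq> S"
  proof
    fix x assume x: "x \<in> space (uniform_sphere d) - ?A"
    then have less: "1 - (x \<bullet> v)\<^sup>2 < ?K * (x \<bullet> v)\<^sup>2" by auto
    then have nz: "x \<bullet> v \<noteq> 0" by auto
    then have "(1 - (x \<bullet> v)\<^sup>2) / (x \<bullet> v)\<^sup>2 \<le> ?K" using less by (simp add: divide_le_eq)
    then show "x \<in> S" using x nz line_angle_unit[of x d v] v_unit by (simp add: S_def)
  qed
  then have "measure (uniform_sphere d) (space (uniform_sphere d) - ?A) \<le> measure (uniform_sphere d) S"
    by (rule finite_measure_mono[OF _ S_sets])
  then show "1 - \<delta> \<le> measure (uniform_sphere d) S"
    using prob_compl[OF A(1)] A(2) by linarith
qed

text \<open>On the event of \<open>tan_tail\<close> the cosine is nonzero, so the pathwise bound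
  applies there and the bound on the tangent can be inserted.\<close>

lemma probabilistic_bound:
  assumes d: "2 \<le> d" and \<delta>: "0 < \<delta>"
  shows "1 - \<delta> \<le> measure (uniform_sphere d) {x \<in> space (uniform_sphere d).
    \<mu> - rayleigh_pow B x q \<le> 0.824\<^sup>2 * real d * \<mu> / \<delta>\<^sup>2 * (M / \<mu>) ^ (2 * q)}"
proof -
  interpret prob_space "uniform_sphere d" using d by (intro prob_space_uniform_sphere) auto
  let ?S = "{x \<in> space (uniform_sphere d). cos (line_angle x v) \<noteq> 0 \<and>
      (tan (line_angle x v))\<^sup>2 \<le> 0.824\<^sup>2 * real d / \<delta>\<^sup>2}"
  let ?T = "{x \<in> space (uniform_sphere d).
    \<mu> - rayleigh_pow B x q \<le> 0.824\<^sup>2 * real d * \<mu> / \<delta>\<^sup>2 * (M / \<mu>) ^ (2 * q)}"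
  have "?S \<subseteq> ?T"
  proof (intro Collect_mono impI conjI; elim conjE)
    fix x assume x: "x \<in> space (uniform_sphere d)" "cos (line_angle x v) \<noteq> 0"
      "(tan (line_angle x v))\<^sup>2 \<le> 0.824\<^sup>2 * real d / \<delta>\<^sup>2"
    have "\<mu> - rayleigh_pow B x q \<le> \<mu> * (M / \<mu>) ^ (2 * q) * (tan (line_angle x v))\<^sup>2"
      using x by (intro pathwise_bound) auto
    also have "\<dots> \<le> \<mu> * (M / \<mu>) ^ (2 * q) * (0.824\<^sup>2 * real d / \<delta>\<^sup>2)"
      using M x(3) by (intro mult_left_mono) auto
    finally show "\<mu> - rayleigh_pow B x q \<le> 0.824\<^sup>2 * real d * \<mu> / \<delta>\<^sup>2 * (M / \<mu>) ^ (2 * q)"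
      by (simp add: mult_ac)
  qed
  moreover have "?T \<in> sets (uniform_sphere d)"
    by (intro borel_measurable_le borel_measurable_diff borel_measurable_const
        measurable_uniform_sphere measurable_rayleigh_pow B)
  ultimately have "measure (uniform_sphere d) ?S \<le> measure (uniform_sphere d) ?T"
    by (rule finite_measure_mono)
  then show ?thesis using tan_tail(2)[OF d \<delta>] by linarith
qed

text \<open>Vectors orthogonal to \<open>v\<close> belong to the exceptional set for every \<delta>,
  so their probability is below every positive number.\<close>

lemma AE_scalar_prod_nonzero:
  assumes d: "2 \<le> d"
  shows "AE x in uniform_sphere d. x \<bullet> v \<noteq> 0"
proof -
  interpret prob_space "uniform_sphere d" using d by (intro prob_space_uniform_sphere) auto
  let ?N = "{x \<in> space (uniform_sphere d). x \<bullet> v = 0}"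
  have N: "?N \<in> sets (uniform_sphere d)"
    by (intro borel_measurable_eq borel_measurable_const measurable_scalar_prod_v)
  have "measure (uniform_sphere d) ?N \<le> 0 + \<delta>" if "0 < \<delta>" for \<delta>
  proof -
    let ?A = "{x \<in> unit_sphere d. (0.824\<^sup>2 * real d / \<delta>\<^sup>2) * (x \<bullet> v)\<^sup>2 \<le> 1 - (x \<bullet> v)\<^sup>2}"
    note A = uniform_sphere_tan_tail[OF d v_unit that]
    have "measure (uniform_sphere d) ?N \<le> measure (uniform_sphere d) ?A"
      by (rule finite_measure_mono[OF _ A(1)]) auto
    then show ?thesis using A(2) by linarith
  qed
  then have "measure (uniform_sphere d) ?N \<le> 0" by (rule field_le_epsilon)
  then have "emeasure (uniform_sphere d) ?N = 0"
    by (simp add: emeasure_eq_measure measure_le_0_iff)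
  then show ?thesis by (subst AE_iff_measurable[OF N]) auto
qed

lemma AE_convergence:
  assumes d: "2 \<le> d" and strict: "M < \<mu>"
  shows "AE x in uniform_sphere d. (\<lambda>q. rayleigh_pow B x q) \<longlonglongrightarrow> \<mu> \<and>
    (\<lambda>q. \<mu> - rayleigh_pow B x q) \<in> O(\<lambda>q. (M / \<mu>) ^ (2 * q))"
  using AE_scalar_prod_nonzero[OF d] AE_space
proof eventually_elim
  case (elim x)
  then have x: "x \<in> carrier_vec d" "x \<bullet> x = 1" "x \<bullet> v \<noteq> 0" by (simp_all add: unit_sphere_iff)
  \<comment> \<open>The constant depends on the starting vector but not on \<open>q\<close>, as the
    almost sure rate demands.\<close>
  define C where "C = \<mu> * ((1 - (x \<bullet> v)\<^sup>2) / (x \<bullet> v)\<^sup>2)"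
  have lo: "0 \<le> \<mu> - rayleigh_pow B x q" and hi: "\<mu> - rayleigh_pow B x q \<le> C * (M / \<mu>) ^ (2 * q)" for q
    using rayleigh_pow_bounds[OF x, of q] by (simp_all add: C_def mult_ac)
  have "norm ((M / \<mu>)\<^sup>2) < 1"
    using M strict by (simp add: power_less_one_iff abs_square_less_1)
  then have "(\<lambda>q. ((M / \<mu>)\<^sup>2) ^ q) \<longlonglongrightarrow> 0" by (rule LIMSEQ_power_zero)
  then have upper: "(\<lambda>q. C * (M / \<mu>) ^ (2 * q)) \<longlonglongrightarrow> 0"
    unfolding power_mult by (rule tendsto_mult_right_zero)
  have "(\<lambda>q. \<mu> - rayleigh_pow B x q) \<longlonglongrightarrow> 0"
    by (rule tendsto_sandwich[OF _ _ tendsto_const upper]) (use lo hi in auto)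
  then have "(\<lambda>q. \<mu> - (\<mu> - rayleigh_pow B x q)) \<longlonglongrightarrow> \<mu> - 0"
    by (intro tendsto_diff tendsto_const)
  moreover have "(\<lambda>q. \<mu> - rayleigh_pow B x q) \<in> O(\<lambda>q. (M / \<mu>) ^ (2 * q))"
  proof (rule bigoI[of _ C], rule always_eventually, rule allI)
    fix q
    have "0 \<le> (M / \<mu>) ^ (2 * q)" using M by simp
    then show "norm (\<mu> - rayleigh_pow B x q) \<le> C * norm ((M / \<mu>) ^ (2 * q))"
      using lo[of q] hi[of q] by simp
  qed
  ultimately show ?case by simp
qed

end

text \<open>The event in (b) also demands a nonzero cosine: at a right angle \<open>tan\<close> is 0
  by convention and would satisfy the bound spuriously.\<close>

theorem theorem3p2:
  shows "\<exists>c::real. 0 < c \<and> c \<le> 0.824 \<and>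
    (\<forall>(n::nat) (p::nat) (d::nat) (A :: nat \<Rightarrow> real mat) (lam :: nat \<Rightarrow> real) (\<gamma>::real) (v1 :: real vec).
      d = n * p \<longrightarrow> 2 \<le> d \<longrightarrow>
      A \<in> carrier_tensor n p \<longrightarrow> T_SPD n p A \<longrightarrow>
      image_mset lam (mset_set {1..d}) = T_eigenvalues n p A \<longrightarrow>
      lam 2 < lam 1 \<longrightarrow> (\<forall>i\<in>{2..<d}. lam (Suc i) \<le> lam i) \<longrightarrow> 0 < lam d \<longrightarrow>
      \<gamma> = 1 - lam 2 / lam 1 \<longrightarrow>
      eigenvector (bcirc n p A) v1 (lam 1) \<longrightarrow> vnorm v1 = 1 \<longrightarrow>
      (\<forall>q. \<forall>x0\<in>unit_sphere d. cos (line_angle x0 v1) \<noteq> 0 \<longrightarrow>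
         lam 1 - rayleigh_pow (bcirc n p A) x0 q
           \<le> lam 1 * (1 - \<gamma>) ^ (2 * q) * (tan (line_angle x0 v1))\<^sup>2) \<and>
      (\<forall>\<delta>. 0 < \<delta> \<longrightarrow> \<delta> < 1 \<longrightarrow>
         measure (uniform_sphere d)
           {x0 \<in> space (uniform_sphere d).
              cos (line_angle x0 v1) \<noteq> 0 \<and>
              (tan (line_angle x0 v1))\<^sup>2 \<le> c\<^sup>2 * real d / \<delta>\<^sup>2} \<ge> 1 - \<delta>) \<and>
      (\<forall>\<delta> q. 0 < \<delta> \<longrightarrow> \<delta> < 1 \<longrightarrow>
         measure (uniform_sphere d)
           {x0 \<in> space (uniform_sphere d).
              lam 1 - rayleigh_pow (bcirc n p A) x0 q
                \<le> c\<^sup>2 * real d * lam 1 / \<delta>\<^sup>2 * (1 - \<gamma>) ^ (2 * q)} \<ge> 1 - \<delta>) \<and>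
      (AE x0 in uniform_sphere d.
         (\<lambda>q. rayleigh_pow (bcirc n p A) x0 q) \<longlonglongrightarrow> lam 1 \<and>
         (\<lambda>q. lam 1 - rayleigh_pow (bcirc n p A) x0 q) \<in> O(\<lambda>q. (1 - \<gamma>) ^ (2 * q))))"
\<comment> \<open>The largest admissible constant leaves room above \<open>sqrt (2 / pi)\<close>,
  the value required by the tail estimate.\<close>
proof (intro exI[of _ "0.824"] conjI allI impI)
  fix n p d :: nat and A :: "nat \<Rightarrow> real mat" and lam :: "nat \<Rightarrow> real" and \<gamma> :: real and v1 :: "real vec"
  assume d: "d = n * p" "2 \<le> d" and A: "T_SPD n p A"
    and lam: "image_mset lam (mset_set {1..d}) = T_eigenvalues n p A"
    and gap: "lam 2 < lam 1" and decr: "\<forall>i\<in>{2..<d}. lam (Suc i) \<le> lam i" and pos: "0 < lam d"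
    and \<gamma>: "\<gamma> = 1 - lam 2 / lam 1"
    and v1: "eigenvector (bcirc n p A) v1 (lam 1)" "vnorm v1 = 1"
  interpret power_method "bcirc n p A" d "lam 1" "lam 2" v1
    by (rule T_SPD_power_method[OF A d lam gap decr pos v1])
  have ratio: "1 - \<gamma> = lam 2 / lam 1" by (simp add: \<gamma>)
  show "\<forall>x0\<in>unit_sphere d. cos (line_angle x0 v1) \<noteq> 0 \<longrightarrow>
      lam 1 - rayleigh_pow (bcirc n p A) x0 q
        \<le> lam 1 * (1 - \<gamma>) ^ (2 * q) * (tan (line_angle x0 v1))\<^sup>2" for q
    unfolding ratio using pathwise_bound by blast
  show "measure (uniform_sphere d) {x0 \<in> space (uniform_sphere d). cos (line_angle x0 v1) \<noteq> 0 \<and>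
      (tan (line_angle x0 v1))\<^sup>2 \<le> 0.824\<^sup>2 * real d / \<delta>\<^sup>2} \<ge> 1 - \<delta>" if "0 < \<delta>" for \<delta>
    by (rule tan_tail(2)[OF d(2) that])
  show "measure (uniform_sphere d) {x0 \<in> space (uniform_sphere d). lam 1 - rayleigh_pow (bcirc n p A) x0 q
      \<le> 0.824\<^sup>2 * real d * lam 1 / \<delta>\<^sup>2 * (1 - \<gamma>) ^ (2 * q)} \<ge> 1 - \<delta>" if "0 < \<delta>" for \<delta> q
    unfolding ratio by (rule probabilistic_bound[OF d(2) that])
  show "AE x0 in uniform_sphere d. (\<lambda>q. rayleigh_pow (bcirc n p A) x0 q) \<longlonglongrightarrow> lam 1 \<and>
      (\<lambda>q. lam 1 - rayleigh_pow (bcirc n p A) x0 q) \<in> O(\<lambda>q. (1 - \<gamma>) ^ (2 * q))"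
    unfolding ratio by (rule AE_convergence[OF d(2) gap])
qed simp_all

end
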